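(* Let $n$ be an integer with $|n|\ge 1$ and let $\mathrm{BS}(1,n)=\langle t,x \mid txt^{-1}=x^n\rangle$ be the solvable Baumslag-Solitar group. Then there exists a finitely presented metabelian group $\Gamma$ with quadratic Dehn function such that $\mathrm{BS}(1,n)$ is isomorphic to a subgroup of $\Gamma$.
   Context: Dehn function: let $\Gamma$ be a finitely presented group with finite symmetric generating set $S$, and let $\ell$ be an integer such that $\Gamma$ has a presentation with generating set $S$ and relators of length $\le \ell$. A relation is a word in the letters of $S$ representing the trivial element of $\Gamma$; its area is the least $m$ such that it is, in the free group on $S$, a product of $\le m$ conjugates of relations of length $\le \ell$. The Dehn function is $\delta(n)=\sup\{\mathrm{area}(w) : w \text{ a relation of length}\le n\}$. It is considered up to the equivalence $\approx$, where $u\approx v$ if there are positive constants $a_1,\dots,a_4,b_1,\dots,b_4$ with $a_1u(a_2n)-a_3n-a_4\le v(n)\le b_1u(b_2n)+b_3n+b_4$ for all $n\ge 0$; up to $\approx$ it does not depend on $(S,\ell)$. "Quadratic Dehn function" means $\delta(n)\approx n^2$. A group is metabelian if its commutator subgroup is abelian. *)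

theory Defs
  imports Complex_Main "HOL-Algebra.Generated_Groups"
begin

section \<open>Words and free groups\<close>

text \<open>The letter \<open>(s, True)\<close> stands for \<open>s\<close> and \<open>(s, False)\<close> for the formal inverse of \<open>s\<close>.\<close>

type_synonym 'a word = "('a \<times> bool) list"

definition words :: "'a set \<Rightarrow> 'a word set" where
  "words S = lists (S \<times> UNIV)"

definition letter_inv :: "'a \<times> bool \<Rightarrow> 'a \<times> bool" where
  "letter_inv x = (fst x, \<not> snd x)"

definition reduced :: "'a word \<Rightarrow> bool" where
  "reduced w \<longleftrightarrow> successively (\<lambda>x y. y \<noteq> letter_inv x) w"

fun push_letter :: "'a \<times> bool \<Rightarrow> 'a word \<Rightarrow> 'a word" where
  "push_letter x [] = [x]"
| "push_letter x (y # w) = (if y = letter_inv x then w else x # y # w)"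

definition free_reduce :: "'a word \<Rightarrow> 'a word" where
  "free_reduce w = foldr push_letter w []"

text \<open>The free group with basis \<open>S\<close>, realised on the freely reduced words. A word \<open>w\<close> over \<open>S\<close>
  represents the element \<open>free_reduce w\<close>.\<close>

definition free_group :: "'a set \<Rightarrow> 'a word monoid" where
  "free_group S = \<lparr>carrier = {w \<in> words S. reduced w},
                   mult = (\<lambda>u v. free_reduce (u @ v)), one = []\<rparr>"

lemma letter_inv_letter_inv [simp]: "letter_inv (letter_inv x) = x"
  by (simp add: letter_inv_def)

lemma reduced_Nil [simp]: "reduced []"
  by (simp add: reduced_def)

lemma reduced_tl: "reduced (x # w) \<Longrightarrow> reduced w"
  by (cases w) (auto simp: reduced_def)

lemma reduced_push_letter: "reduced w \<Longrightarrow> reduced (push_letter x w)"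
  by (cases w) (auto simp: reduced_def successively_Cons)

lemma push_letter_cancel:
  "reduced w \<Longrightarrow> push_letter x (push_letter (letter_inv x) w) = w"
  by (cases w; cases "tl w") (auto simp: reduced_def)

lemma reduced_foldr: "reduced w \<Longrightarrow> reduced (foldr push_letter u w)"
  by (induction u) (auto intro: reduced_push_letter)

lemma reduced_free_reduce [simp]: "reduced (free_reduce w)"
  by (simp add: free_reduce_def reduced_foldr)

lemma free_reduce_reduced [simp]: "reduced w \<Longrightarrow> free_reduce w = w"
proof (induction w)
  case (Cons x w)
  then have "free_reduce w = w" by (blast dest: reduced_tl)
  then have "free_reduce (x # w) = push_letter x w" by (simp add: free_reduce_def)
  also have "\<dots> = x # w" using Cons.prems by (cases w) (auto simp: reduced_def)
  finally show ?case .
qed (simp add: free_reduce_def)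

lemma foldr_push_push:
  "reduced w \<Longrightarrow> foldr push_letter (push_letter x r) w = push_letter x (foldr push_letter r w)"
  by (cases r) (auto simp: push_letter_cancel reduced_foldr)

lemma foldr_free_reduce:
  "reduced w \<Longrightarrow> foldr push_letter (free_reduce u) w = foldr push_letter u w"
proof (induction u)
  case (Cons x u)
  have "free_reduce (x # u) = push_letter x (free_reduce u)" by (simp add: free_reduce_def)
  then show ?case using Cons by (simp add: foldr_push_push)
qed (simp add: free_reduce_def)

lemma free_reduce_append: "free_reduce (u @ v) = foldr push_letter u (free_reduce v)"
  by (simp add: free_reduce_def)

lemma free_reduce_append_left [simp]: "free_reduce (free_reduce u @ v) = free_reduce (u @ v)"
  by (simp add: free_reduce_append foldr_free_reduce)

lemma free_reduce_append_right [simp]: "free_reduce (u @ free_reduce v) = free_reduce (u @ v)"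
  by (simp add: free_reduce_append)

lemma inverse_word_in_words: "w \<in> words S \<Longrightarrow> rev (map letter_inv w) \<in> words S"
  by (induction w) (auto simp: words_def letter_inv_def)

lemma push_letter_words: "x \<in> S \<times> UNIV \<Longrightarrow> w \<in> words S \<Longrightarrow> push_letter x w \<in> words S"
  by (cases w) (auto simp: words_def)

lemma free_reduce_words: "w \<in> words S \<Longrightarrow> free_reduce w \<in> words S"
proof (induction w)
  case (Cons x w)
  then have "x \<in> S \<times> UNIV" "w \<in> words S" by (auto simp: words_def)
  with Cons.IH push_letter_words show ?case by (fastforce simp: free_reduce_def)
qed (simp add: free_reduce_def)

lemma free_reduce_in_free_group: "w \<in> words S \<Longrightarrow> free_reduce w \<in> carrier (free_group S)"
  by (simp add: free_group_def free_reduce_words)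

lemma free_reduce_inverse: "free_reduce (rev (map letter_inv w) @ w) = []"
proof (induction w)
  case (Cons x w)
  have "free_reduce (letter_inv x # x # w) = free_reduce w"
    using push_letter_cancel[OF reduced_free_reduce, of "letter_inv x" w]
    by (simp add: free_reduce_def)
  then have "free_reduce (rev (map letter_inv w) @ letter_inv x # x # w)
      = free_reduce (rev (map letter_inv w) @ w)"
    by (simp only: free_reduce_append)
  then show ?case using Cons by simp
qed (simp add: free_reduce_def)

lemma group_free_group: "group (free_group S)"
proof (rule groupI)
  fix u assume u: "u \<in> carrier (free_group S)"
  let ?v = "free_reduce (rev (map letter_inv u))"
  have "rev (map letter_inv u) \<in> words S"
    using u by (simp add: free_group_def inverse_word_in_words)
  then have "?v \<in> carrier (free_group S)" by (rule free_reduce_in_free_group)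
  moreover have "?v \<otimes>\<^bsub>free_group S\<^esub> u = \<one>\<^bsub>free_group S\<^esub>"
    by (simp add: free_group_def free_reduce_inverse)
  ultimately show "\<exists>v\<in>carrier (free_group S). v \<otimes>\<^bsub>free_group S\<^esub> u = \<one>\<^bsub>free_group S\<^esub>" ..
qed (auto simp: free_group_def words_def[symmetric] intro: free_reduce_words, auto simp: words_def
      intro!: free_reduce_words[unfolded words_def])

section \<open>Presentations\<close>

definition normal_closure :: "('a, 'b) monoid_scheme \<Rightarrow> 'a set \<Rightarrow> 'a set" where
  "normal_closure G R = generate G {g \<otimes>\<^bsub>G\<^esub> r \<otimes>\<^bsub>G\<^esub> inv\<^bsub>G\<^esub> g | g r. g \<in> carrier G \<and> r \<in> R}"

lemma (in group) normal_normal_closure: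
  assumes "R \<subseteq> carrier G"
  shows "normal_closure G R \<lhd> G"
  unfolding normal_closure_def
proof (rule normal_generateI)
  show "{g \<otimes> r \<otimes> inv g | g r. g \<in> carrier G \<and> r \<in> R} \<subseteq> carrier G" using assms by auto
next
  fix h k
  assume "h \<in> {g \<otimes> r \<otimes> inv g | g r. g \<in> carrier G \<and> r \<in> R}" and k: "k \<in> carrier G"
  then obtain g r where gr: "h = g \<otimes> r \<otimes> inv g" "g \<in> carrier G" "r \<in> R" by auto
  with assms k have "k \<otimes> h \<otimes> inv k = (k \<otimes> g) \<otimes> r \<otimes> inv (k \<otimes> g)"
    by (simp add: m_assoc inv_mult_group subset_iff)
  with gr k show "k \<otimes> h \<otimes> inv k \<in> {g \<otimes> r \<otimes> inv g | g r. g \<in> carrier G \<and> r \<in> R}" by blast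
qed

definition presented_group :: "'a set \<Rightarrow> 'a word set \<Rightarrow> 'a word set monoid" where
  "presented_group X R = free_group X Mod normal_closure (free_group X) (free_reduce ` R)"

lemma group_presented_group: "R \<subseteq> words X \<Longrightarrow> group (presented_group X R)"
  unfolding presented_group_def
  by (intro normal.factorgroup_is_group group.normal_normal_closure group_free_group)
     (auto intro: free_reduce_in_free_group)

definition word_val :: "('a, 'b) monoid_scheme \<Rightarrow> 'a word \<Rightarrow> 'a" where
  "word_val G w = foldr (\<lambda>(s, e) g. (if e then s else inv\<^bsub>G\<^esub> s) \<otimes>\<^bsub>G\<^esub> g) w \<one>\<^bsub>G\<^esub>"

text \<open>\<open>S\<close> is a subset of the group \<open>G\<close> that generates it, and the kernel of the canonical
  homomorphism from the free group on \<open>S\<close> to \<open>G\<close> is normally generated by the relators \<open>R\<close>.\<close>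

definition presentation :: "('a, 'b) monoid_scheme \<Rightarrow> 'a set \<Rightarrow> 'a word set \<Rightarrow> bool" where
  "presentation G S R \<longleftrightarrow>
     S \<subseteq> carrier G \<and> generate G S = carrier G \<and> R \<subseteq> words S \<and>
     kernel (free_group S) G (word_val G) = normal_closure (free_group S) (free_reduce ` R)"

definition finitely_presented :: "('a, 'b) monoid_scheme \<Rightarrow> bool" where
  "finitely_presented G \<longleftrightarrow> (\<exists>S R. finite S \<and> finite R \<and> presentation G S R)"

context group
begin

lemma word_val_Nil [simp]: "word_val G [] = \<one>"
  by (simp add: word_val_def)

lemma word_val_Cons:
  "word_val G (x # w) = (if snd x then fst x else inv (fst x)) \<otimes> word_val G w"
  by (simp add: word_val_def case_prod_beta)

lemma word_val_closed:
  assumes "S \<subseteq> carrier G" shows "w \<in> words S \<Longrightarrow> word_val G w \<in> carrier G"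
  using assms by (induction w) (auto simp: word_val_Cons words_def)

lemma word_val_append:
  assumes "S \<subseteq> carrier G" "v \<in> words S"
  shows "u \<in> words S \<Longrightarrow> word_val G (u @ v) = word_val G u \<otimes> word_val G v"
proof (induction u)
  case Nil
  then show ?case using assms word_val_closed by auto
next
  case (Cons x u)
  then have "u \<in> words S" "fst x \<in> carrier G" using assms by (auto simp: words_def)
  with Cons.IH show ?case
    using assms word_val_closed by (simp add: word_val_Cons m_assoc)
qed

lemma word_val_push_letter:
  assumes "S \<subseteq> carrier G" "x # w \<in> words S"
  shows "word_val G (push_letter x w) = word_val G (x # w)"
proof (cases w)
  case (Cons y v)
  then have "v \<in> words S" "fst x \<in> carrier G" using assms by (auto simp: words_def)
  then show ?thesis using Cons word_val_closed[OF assms(1)]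
    by (auto simp: word_val_Cons letter_inv_def m_assoc[symmetric])
qed simp

lemma word_val_free_reduce:
  assumes "S \<subseteq> carrier G"
  shows "w \<in> words S \<Longrightarrow> word_val G (free_reduce w) = word_val G w"
proof (induction w)
  case (Cons x w)
  then have w: "w \<in> words S" "x \<in> S \<times> UNIV" by (auto simp: words_def)
  then have "x # free_reduce w \<in> words S" using free_reduce_words by (fastforce simp: words_def)
  then have "word_val G (push_letter x (free_reduce w)) = word_val G (x # free_reduce w)"
    by (rule word_val_push_letter[OF assms])
  also have "\<dots> = word_val G (x # w)" using Cons.IH w by (simp add: word_val_Cons)
  finally show ?case by (simp add: free_reduce_def)
qed (simp add: free_reduce_def)

lemma word_val_hom:
  assumes "S \<subseteq> carrier G"
  shows "word_val G \<in> hom (free_group S) G"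
proof (rule homI)
  fix u v assume uv: "u \<in> carrier (free_group S)" "v \<in> carrier (free_group S)"
  then have "u @ v \<in> words S" by (auto simp: free_group_def words_def)
  with uv show "word_val G (u \<otimes>\<^bsub>free_group S\<^esub> v) = word_val G u \<otimes> word_val G v"
    using word_val_free_reduce[OF assms] word_val_append[OF assms] by (simp add: free_group_def)
qed (use word_val_closed[OF assms] in \<open>auto simp: free_group_def\<close>)

end

section \<open>Dehn functions\<close>

definition relations :: "('a, 'b) monoid_scheme \<Rightarrow> 'a set \<Rightarrow> 'a word set" where
  "relations G S = {w \<in> words S. word_val G w = \<one>\<^bsub>G\<^esub>}"

definition dehn_data :: "('a, 'b) monoid_scheme \<Rightarrow> 'a set \<Rightarrow> nat \<Rightarrow> bool" where
  "dehn_data G S l \<longleftrightarrow>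
     finite S \<and> (\<forall>s\<in>S. inv\<^bsub>G\<^esub> s \<in> S) \<and> (\<exists>R. presentation G S R \<and> (\<forall>r\<in>R. length r \<le> l))"

definition conj_product :: "'a set \<Rightarrow> ('a word \<times> 'a word) list \<Rightarrow> 'a word" where
  "conj_product S ps =
     foldr (\<lambda>(g, r) p. (g \<otimes>\<^bsub>free_group S\<^esub> free_reduce r \<otimes>\<^bsub>free_group S\<^esub> inv\<^bsub>free_group S\<^esub> g)
                         \<otimes>\<^bsub>free_group S\<^esub> p)
       ps \<one>\<^bsub>free_group S\<^esub>"

definition fills_with ::
    "('a, 'b) monoid_scheme \<Rightarrow> 'a set \<Rightarrow> nat \<Rightarrow> 'a word \<Rightarrow> nat \<Rightarrow> bool" where
  "fills_with G S l w m \<longleftrightarrow>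
     (\<exists>ps. length ps \<le> m \<and>
        (\<forall>(g, r)\<in>set ps. g \<in> carrier (free_group S) \<and> r \<in> relations G S \<and> length r \<le> l) \<and>
        free_reduce w = conj_product S ps)"

definition area :: "('a, 'b) monoid_scheme \<Rightarrow> 'a set \<Rightarrow> nat \<Rightarrow> 'a word \<Rightarrow> nat" where
  "area G S l w = (LEAST m. fills_with G S l w m)"

text \<open>The argument is real because \<open>\<approx>\<close> rescales it by real constants. For Dehn data \<open>(S, l)\<close>
  the supremum is over a finite set, and every relation has a filling; see
  \<open>finite_relations_le\<close> and \<open>relation_has_filling\<close> below.\<close>

definition dehn_function :: "('a, 'b) monoid_scheme \<Rightarrow> 'a set \<Rightarrow> nat \<Rightarrow> real \<Rightarrow> real" where
  "dehn_function G S l x =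
     real (Sup {area G S l w | w. w \<in> relations G S \<and> real (length w) \<le> x})"

definition dehn_equiv :: "(real \<Rightarrow> real) \<Rightarrow> (real \<Rightarrow> real) \<Rightarrow> bool" (infix \<open>\<approx>\<close> 50) where
  "u \<approx> v \<longleftrightarrow>
     (\<exists>a1 a2 a3 a4 b1 b2 b3 b4 :: real.
        a1 > 0 \<and> a2 > 0 \<and> a3 > 0 \<and> a4 > 0 \<and> b1 > 0 \<and> b2 > 0 \<and> b3 > 0 \<and> b4 > 0 \<and>
        (\<forall>n\<ge>0. a1 * u (a2 * n) - a3 * n - a4 \<le> v n \<and> v n \<le> b1 * u (b2 * n) + b3 * n + b4))"

definition quadratic_dehn_function :: "('a, 'b) monoid_scheme \<Rightarrow> bool" where
  "quadratic_dehn_function G \<longleftrightarrow>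
     (\<exists>S l. dehn_data G S l \<and> dehn_function G S l \<approx> (\<lambda>n. n\<^sup>2))"

lemma finite_relations_le:
  assumes "finite S"
  shows "finite {w \<in> relations G S. real (length w) \<le> x}"
proof (rule finite_subset)
  show "{w \<in> relations G S. real (length w) \<le> x}
      \<subseteq> {w. set w \<subseteq> S \<times> UNIV \<and> length w \<le> nat \<lfloor>x\<rfloor>}"
    by (auto simp: relations_def words_def le_nat_floor)
  show "finite {w. set w \<subseteq> S \<times> (UNIV :: bool set) \<and> length w \<le> nat \<lfloor>x\<rfloor>}"
    using assms by (intro finite_lists_length_le) simp
qed

lemma conj_product_closed:
  assumes "\<forall>(g, r)\<in>set ps. g \<in> carrier (free_group S) \<and> r \<in> words S"
  shows "conj_product S ps \<in> carrier (free_group S)"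
proof -
  interpret F: group "free_group S" by (rule group_free_group)
  show ?thesis using assms
    by (induction ps) (auto simp: conj_product_def free_reduce_in_free_group)
qed

lemma conj_product_append:
  assumes "\<forall>(g, r)\<in>set ps. g \<in> carrier (free_group S) \<and> r \<in> words S"
    and "\<forall>(g, r)\<in>set qs. g \<in> carrier (free_group S) \<and> r \<in> words S"
  shows "conj_product S (ps @ qs) = conj_product S ps \<otimes>\<^bsub>free_group S\<^esub> conj_product S qs"
  using assms(1)
proof (induction ps)
  interpret F: group "free_group S" by (rule group_free_group)
  case Nil
  then show ?case using conj_product_closed[OF assms(2)] by (simp add: conj_product_def)
next
  interpret F: group "free_group S" by (rule group_free_group)
  case (Cons p ps)
  obtain g r where p: "p = (g, r)" by fastforce
  with Cons.prems have gr: "g \<in> carrier (free_group S)" "free_reduce r \<in> carrier (free_group S)"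
    and ps: "\<forall>(g, r)\<in>set ps. g \<in> carrier (free_group S) \<and> r \<in> words S"
    by (auto simp: free_reduce_in_free_group)
  have step: "conj_product S (p # xs) = (g \<otimes>\<^bsub>free_group S\<^esub> free_reduce r \<otimes>\<^bsub>free_group S\<^esub>
      inv\<^bsub>free_group S\<^esub> g) \<otimes>\<^bsub>free_group S\<^esub> conj_product S xs" for xs
    by (simp add: conj_product_def p)
  show ?case
    using gr Cons.IH[OF ps] conj_product_closed[OF ps] conj_product_closed[OF assms(2)]
    by (simp add: step F.m_assoc)
qed

lemma free_group_inv:
  assumes "w \<in> words S"
  shows "inv\<^bsub>free_group S\<^esub> (free_reduce w) = free_reduce (rev (map letter_inv w))"
proof -
  interpret F: group "free_group S" by (rule group_free_group)
  have w': "rev (map letter_inv w) \<in> words S"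
    using assms by (rule inverse_word_in_words)
  have "free_reduce (rev (map letter_inv w)) \<otimes>\<^bsub>free_group S\<^esub> free_reduce w
      = \<one>\<^bsub>free_group S\<^esub>"
    by (simp add: free_group_def free_reduce_inverse)
  then show ?thesis
    using F.inv_equality free_reduce_in_free_group assms w' by metis
qed

lemma relation_has_filling:
  assumes "group G" and "dehn_data G S l" and w: "w \<in> relations G S"
  shows "fills_with G S l w (area G S l w)"
proof -
  interpret group G by fact
  interpret F: group "free_group S" by (rule group_free_group)
  obtain R where R: "presentation G S R" "\<forall>r\<in>R. length r \<le> l"
    using assms by (auto simp: dehn_data_def)
  then have SG: "S \<subseteq> carrier G" and RS: "R \<subseteq> words S"
    and ker: "kernel (free_group S) G (word_val G) = normal_closure (free_group S) (free_reduce ` R)"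
    by (auto simp: presentation_def)
  interpret h: group_hom "free_group S" G "word_val G"
    using word_val_hom[OF SG] by unfold_locales
  let ?C = "{g \<otimes>\<^bsub>free_group S\<^esub> r \<otimes>\<^bsub>free_group S\<^esub> inv\<^bsub>free_group S\<^esub> g | g r.
     g \<in> carrier (free_group S) \<and> r \<in> free_reduce ` R}"
  have R_rel: "r \<in> relations G S \<and> rev (map letter_inv r) \<in> relations G S" if "r \<in> R" for r
  proof -
    have rS: "r \<in> words S" "rev (map letter_inv r) \<in> words S"
      using that RS inverse_word_in_words by blast+
    have c: "free_reduce r \<in> carrier (free_group S)"
      using rS by (rule_tac free_reduce_in_free_group)
    have "\<one>\<^bsub>free_group S\<^esub> \<otimes>\<^bsub>free_group S\<^esub> free_reduce r \<otimes>\<^bsub>free_group S\<^esub>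
        inv\<^bsub>free_group S\<^esub> \<one>\<^bsub>free_group S\<^esub> \<in> ?C"
      using that by blast
    then have "free_reduce r \<in> normal_closure (free_group S) (free_reduce ` R)"
      using c unfolding normal_closure_def by (simp add: generate.incl)
    then have val: "word_val G (free_reduce r) = \<one>\<^bsub>G\<^esub>" using ker by (auto simp: kernel_def)
    then have "word_val G (inv\<^bsub>free_group S\<^esub> (free_reduce r)) = \<one>\<^bsub>G\<^esub>" using c by simp
    with val show ?thesis
      using rS word_val_free_reduce[OF SG] free_group_inv[OF rS(1)] by (auto simp: relations_def)
  qed
  let ?ok = "\<lambda>ps. \<forall>(g, r)\<in>set ps. g \<in> carrier (free_group S) \<and> r \<in> relations G S \<and> length r \<le> l"
  have sub: "\<exists>ps. ?ok ps \<and> v = conj_product S ps"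
    if "v \<in> normal_closure (free_group S) (free_reduce ` R)" for v
    using that unfolding normal_closure_def
  proof (induction rule: generate.induct)
    case one
    have "?ok [] \<and> \<one>\<^bsub>free_group S\<^esub> = conj_product S []" by (simp add: conj_product_def)
    then show ?case by blast
  next
    case (incl h)
    then obtain g r where gr: "g \<in> carrier (free_group S)" "r \<in> R"
      "h = g \<otimes>\<^bsub>free_group S\<^esub> free_reduce r \<otimes>\<^bsub>free_group S\<^esub> inv\<^bsub>free_group S\<^esub> g" by auto
    then have "free_reduce r \<in> carrier (free_group S)" using RS free_reduce_in_free_group by blast
    with gr R R_rel have "?ok [(g, r)] \<and> h = conj_product S [(g, r)]"
      by (simp add: conj_product_def)
    then show ?case by blast
  next
    case (inv h)
    then obtain g r where gr: "g \<in> carrier (free_group S)" "r \<in> R"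
      "h = g \<otimes>\<^bsub>free_group S\<^esub> free_reduce r \<otimes>\<^bsub>free_group S\<^esub> inv\<^bsub>free_group S\<^esub> g" by auto
    let ?r = "rev (map letter_inv r)"
    have rc: "free_reduce r \<in> carrier (free_group S)"
      using gr RS free_reduce_in_free_group by blast
    have r': "free_reduce ?r = inv\<^bsub>free_group S\<^esub> (free_reduce r)"
      using free_group_inv gr RS by (metis subsetD)
    have "inv\<^bsub>free_group S\<^esub> h
        = g \<otimes>\<^bsub>free_group S\<^esub> free_reduce ?r \<otimes>\<^bsub>free_group S\<^esub> inv\<^bsub>free_group S\<^esub> g"
      using gr rc by (simp add: r' F.inv_mult_group F.m_assoc)
    with gr R R_rel rc have "?ok [(g, ?r)] \<and> inv\<^bsub>free_group S\<^esub> h = conj_product S [(g, ?r)]"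
      by (simp add: conj_product_def r')
    then show ?case by blast
  next
    case (eng h1 h2)
    then obtain ps qs where *: "?ok ps" "h1 = conj_product S ps" "?ok qs" "h2 = conj_product S qs"
      by blast
    have "h1 \<otimes>\<^bsub>free_group S\<^esub> h2 = conj_product S (ps @ qs)"
      unfolding *(2,4) using *(1,3)
      by (intro conj_product_append[symmetric]) (auto simp: relations_def)
    moreover have "?ok (ps @ qs)" using *(1,3) by auto
    ultimately show ?case by blast
  qed
  have "free_reduce w \<in> kernel (free_group S) G (word_val G)"
    using w word_val_free_reduce[OF SG] free_reduce_in_free_group
    by (auto simp: kernel_def relations_def)
  then obtain ps where "?ok ps" "free_reduce w = conj_product S ps" using sub ker by blast
  then have "fills_with G S l w (length ps)" unfolding fills_with_def by blast
  then show ?thesis unfolding area_def by (rule LeastI)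
qed

section \<open>Metabelian groups and solvable Baumslag--Solitar groups\<close>

definition metabelian :: "('a, 'b) monoid_scheme \<Rightarrow> bool" where
  "metabelian G \<longleftrightarrow> group G \<and> comm_group (G\<lparr>carrier := derived G (carrier G)\<rparr>)"

datatype bs_gen = BS_t | BS_x

definition bs_relator :: "int \<Rightarrow> bs_gen word" where
  "bs_relator n =
     (let F = free_group (UNIV :: bs_gen set); t = [(BS_t, True)]; x = [(BS_x, True)]
      in (t \<otimes>\<^bsub>F\<^esub> x \<otimes>\<^bsub>F\<^esub> inv\<^bsub>F\<^esub> t) \<otimes>\<^bsub>F\<^esub> inv\<^bsub>F\<^esub> (x [^]\<^bsub>F\<^esub> n))"

definition BS1 :: "int \<Rightarrow> bs_gen word set monoid" where
  "BS1 n = presented_group UNIV {bs_relator n}"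

lemma group_BS1: "group (BS1 n)"
  unfolding BS1_def by (rule group_presented_group) (auto simp: words_def)

end

theory Submission
  imports Defs "HOL-Library.Countable" "HOL-Library.Product_Plus"
begin

text \<open>
  With \<open>P = 2|n|\<close> and \<open>Q = P + 1\<close>, let \<open>\<Gamma>\<close> be the semidirect product of \<open>A = \<int>[1/(PQ)]\<close> with
  \<open>\<int>\<^sup>3\<close>, the three generators acting by multiplication by \<open>P\<close>, \<open>Q\<close> and \<open>n\<close>; the third one
  together with \<open>1 \<in> A\<close> generates a copy of \<open>BS(1,n)\<close>.

  For the upper bound on the Dehn function, \<open>\<Gamma>\<close> is embedded diagonally in the semidirect product of
  \<open>A\<^sup>3\<close> with \<open>\<int>\<^sup>3\<close>, where the three copies of \<open>A\<close> carry the archimedean, the \<open>P\<close>-adic and the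
  \<open>Q\<close>-adic size. Its (infinitely many) generators are the elements of size at most one in a
  single copy and the unit vectors of \<open>\<int>\<^sup>3\<close>. An element of a copy of size \<open>exp m\<close> is a conjugate,
  by a word of length \<open>O(m)\<close>, of a generator, and two such elements commute at cost \<open>O(m\<^sup>2)\<close> because
  any two of the three copies are contracted simultaneously by some element of \<open>\<int>\<^sup>3\<close>. Hence normal
  forms multiply at quadratic cost, and bisecting a word fills it at quadratic cost. By strong
  approximation every element of the big group is at bounded distance from \<open>\<Gamma>\<close>, which transports
  the fillings to \<open>\<Gamma>\<close>.

  For the lower bound, the signed area enclosed by the projection of a relation to \<open>\<int>\<^sup>2\<close> is additive
  over products of conjugates, and the commutator of \<open>k\<close>-th powers encloses area \<open>k\<^sup>2\<close>.
\<close>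

section \<open>Rewriting with counted steps\<close>

text \<open>Since \<open>chain_refl\<close> accepts every \<open>m\<close>, the counter is an upper
  bound for the number of replacements, so that costs may be rounded up
  (\<open>chain_mono\<close>).\<close>

inductive chain :: "('a list \<Rightarrow> 'a list \<Rightarrow> bool) \<Rightarrow> nat \<Rightarrow> 'a list \<Rightarrow> 'a list \<Rightarrow> bool" for R where
  chain_refl: "chain R m w w"
| chain_step: "R a b \<Longrightarrow> chain R m (u @ b @ v) w \<Longrightarrow> chain R (Suc m) (u @ a @ v) w"

lemma chain_mono: "chain R m u v \<Longrightarrow> m \<le> m' \<Longrightarrow> chain R m' u v"
proof (induction arbitrary: m' rule: chain.induct)
  case (chain_step a b m u v w)
  then obtain k where "m' = Suc k" "m \<le> k" by (cases m') auto
  with chain_step show ?case by (auto intro: chain.chain_step)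
qed (rule chain.chain_refl)

lemma chain_trans: "chain R m u v \<Longrightarrow> chain R m' v w \<Longrightarrow> chain R (m + m') u w"
proof (induction rule: chain.induct)
  case (chain_refl m w)
  then show ?case by (rule chain_mono) simp
next
  case (chain_step a b m u v w)
  then show ?case by (auto intro: chain.chain_step)
qed

lemma chain_one: "R a b \<Longrightarrow> chain R (Suc 0) a b"
  using chain.chain_step[of R a b 0 "[]" "[]" b] by (simp add: chain.chain_refl)

lemma chain_context: "chain R m u v \<Longrightarrow> chain R m (x @ u @ y) (x @ v @ y)"
proof (induction rule: chain.induct)
  case (chain_step a b m u v w)
  then show ?case using chain.chain_step[of R a b m "x @ u" "v @ y"] by simp
qed (rule chain.chain_refl)

lemma chain_append_left: "chain R m u v \<Longrightarrow> chain R m (x @ u) (x @ v)"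
  using chain_context[of R m u v x "[]"] by simp

lemma chain_append_right: "chain R m u v \<Longrightarrow> chain R m (u @ y) (v @ y)"
  using chain_context[of R m u v "[]" y] by simp

lemma chain_append: "chain R m u v \<Longrightarrow> chain R m' x y \<Longrightarrow> chain R (m + m') (u @ x) (v @ y)"
  by (rule chain_trans[OF chain_append_right chain_append_left])

lemma chain_sym:
  assumes "\<And>a b. R a b \<Longrightarrow> R b a"
  shows "chain R m u v \<Longrightarrow> chain R m v u"
proof (induction rule: chain.induct)
  case (chain_step a b m u v w)
  have "chain R (Suc 0) (u @ b @ v) (u @ a @ v)"
    using chain_step assms by (intro chain_context chain_one) auto
  with chain_step.IH show ?case using chain_trans by fastforce
qed (rule chain.chain_refl)

section \<open>From replacements to products of conjugates of short relations\<close>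

definition short_eq :: "('a, 'b) monoid_scheme \<Rightarrow> 'a set \<Rightarrow> nat \<Rightarrow> 'a word \<Rightarrow> 'a word \<Rightarrow> bool" where
  "short_eq G S l a b \<longleftrightarrow> a \<in> words S \<and> b \<in> words S \<and> length a \<le> l \<and> length b \<le> l \<and>
     word_val G a = word_val G b"

lemma words_append [simp]: "u @ v \<in> words S \<longleftrightarrow> u \<in> words S \<and> v \<in> words S"
  by (auto simp: words_def)

lemma words_Nil [simp]: "[] \<in> words S"
  by (simp add: words_def)

lemma words_Cons [simp]: "x # w \<in> words S \<longleftrightarrow> fst x \<in> S \<and> w \<in> words S"
  by (cases x) (auto simp: words_def)

lemma free_group_mult_free_reduce:
  "free_reduce u \<otimes>\<^bsub>free_group S\<^esub> free_reduce v = free_reduce (u @ v)"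
  by (simp add: free_group_def)

lemma (in group) word_val_inverse:
  assumes "S \<subseteq> carrier G" "w \<in> words S"
  shows "word_val G (rev (map letter_inv w)) = inv (word_val G w)"
proof -
  have "word_val G (rev (map letter_inv w)) \<otimes> word_val G w = word_val G (rev (map letter_inv w) @ w)"
    using word_val_append[OF assms(1) assms(2)] inverse_word_in_words[OF assms(2)] by simp
  also have "\<dots> = word_val G (free_reduce (rev (map letter_inv w) @ w))"
    using word_val_free_reduce[OF assms(1)] assms(2) inverse_word_in_words[OF assms(2)] by simp
  also have "\<dots> = \<one>" by (simp add: free_reduce_inverse)
  finally show ?thesis
    using inv_equality word_val_closed[OF assms(1)] assms(2) inverse_word_in_words by metis
qed

text \<open>In the free group \<open>u a v = (u (a b^-1) u^-1) (u b v)\<close>, so each replacement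
  contributes one conjugate of the relation \<open>a b^-1\<close>. Both \<open>a\<close> and
  \<open>b\<close> have length at most \<open>l\<close>, whence the bound
  \<open>2 * l\<close>.\<close>

lemma (in group) chain_conj_product:
  assumes S: "S \<subseteq> carrier G"
  shows "chain (short_eq G S l) m w w' \<Longrightarrow> w \<in> words S \<Longrightarrow>
    \<exists>ps. length ps \<le> m \<and>
      (\<forall>(g, r)\<in>set ps. g \<in> carrier (free_group S) \<and> r \<in> relations G S \<and> length r \<le> 2 * l) \<and>
      free_reduce w = conj_product S ps \<otimes>\<^bsub>free_group S\<^esub> free_reduce w'"
proof (induction rule: chain.induct)
  interpret F: group "free_group S" by (rule group_free_group)
  case (chain_refl m w)
  then show ?case by (intro exI[of _ "[]"]) (simp add: conj_product_def free_reduce_in_free_group)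
next
  interpret F: group "free_group S" by (rule group_free_group)
  case (chain_step a b m u v w)
  from chain_step.hyps have ab: "a \<in> words S" "b \<in> words S" "length a \<le> l" "length b \<le> l"
      "word_val G a = word_val G b"
    by (auto simp: short_eq_def)
  from chain_step.prems have uv: "u \<in> words S" "v \<in> words S" by auto
  obtain ps where ps: "length ps \<le> m"
      "\<forall>(g, r)\<in>set ps. g \<in> carrier (free_group S) \<and> r \<in> relations G S \<and> length r \<le> 2 * l"
      "free_reduce (u @ b @ v) = conj_product S ps \<otimes>\<^bsub>free_group S\<^esub> free_reduce w"
    using chain_step.IH ab uv by auto
  let ?F = "free_group S" and ?b = "rev (map letter_inv b)"
  let ?r = "a @ ?b"
  have b': "?b \<in> words S" using ab(2) by (rule inverse_word_in_words)
  have rel: "?r \<in> relations G S"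
    using ab b' word_val_append[OF S b' ab(1)] word_val_inverse[OF S ab(2)] word_val_closed[OF S ab(2)]
    by (simp add: relations_def)
  have cl: "free_reduce u \<in> carrier ?F" "free_reduce v \<in> carrier ?F" "free_reduce a \<in> carrier ?F"
      "free_reduce b \<in> carrier ?F"
    using ab uv free_reduce_in_free_group by auto
  have pc: "conj_product S ps \<in> carrier ?F"
    by (rule conj_product_closed) (use ps(2) in \<open>auto simp: relations_def\<close>)
  have r: "free_reduce ?r = free_reduce a \<otimes>\<^bsub>?F\<^esub> inv\<^bsub>?F\<^esub> free_reduce b"
    by (simp add: free_group_inv[OF ab(2)] free_group_mult_free_reduce)
  have split: "free_reduce (u @ c @ v) = free_reduce u \<otimes>\<^bsub>?F\<^esub> free_reduce c \<otimes>\<^bsub>?F\<^esub> free_reduce v" for c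
    by (simp add: free_group_mult_free_reduce)
  have cancel: "inv\<^bsub>?F\<^esub> x \<otimes>\<^bsub>?F\<^esub> (x \<otimes>\<^bsub>?F\<^esub> y) = y"
    if "x \<in> carrier ?F" "y \<in> carrier ?F" for x y
    using that by (simp add: F.m_assoc[symmetric])
  have w: "w \<in> words S" using chain_step.hyps(2) ab uv
  proof -
    have "chain (short_eq G S l) m x y \<Longrightarrow> x \<in> words S \<Longrightarrow> y \<in> words S" for x y
      by (induction rule: chain.induct) (auto simp: short_eq_def)
    then show ?thesis using chain_step.hyps(2) ab uv by auto
  qed
  then have wc: "free_reduce w \<in> carrier ?F" by (rule free_reduce_in_free_group)
  have "free_reduce (u @ a @ v) =
      (free_reduce u \<otimes>\<^bsub>?F\<^esub> free_reduce ?r \<otimes>\<^bsub>?F\<^esub> inv\<^bsub>?F\<^esub> free_reduce u) \<otimes>\<^bsub>?F\<^esub> free_reduce (u @ b @ v)"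
    unfolding r split using cl by (simp add: F.m_assoc cancel)
  also have "\<dots> = conj_product S ((free_reduce u, ?r) # ps) \<otimes>\<^bsub>?F\<^esub> free_reduce w"
  proof -
    have "free_reduce ?r \<in> carrier ?F" unfolding r using cl by simp
    then show ?thesis unfolding ps(3) using cl pc wc by (simp add: conj_product_def F.m_assoc)
  qed
  finally have "free_reduce (u @ a @ v) = conj_product S ((free_reduce u, ?r) # ps) \<otimes>\<^bsub>?F\<^esub> free_reduce w" .
  with ps(1,2) ab rel cl show ?case by (intro exI[of _ "(free_reduce u, ?r) # ps"]) auto
qed

lemma (in group) chain_fills_with:
  assumes "S \<subseteq> carrier G" "w \<in> words S" "chain (short_eq G S l) m w []"
  shows "fills_with G S (2 * l) w m"
proof -
  interpret F: group "free_group S" by (rule group_free_group)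
  obtain ps where ps: "length ps \<le> m"
      "\<forall>(g, r)\<in>set ps. g \<in> carrier (free_group S) \<and> r \<in> relations G S \<and> length r \<le> 2 * l"
      "free_reduce w = conj_product S ps \<otimes>\<^bsub>free_group S\<^esub> free_reduce []"
    using chain_conj_product[OF assms(1,3,2)] by blast
  moreover have "conj_product S ps \<in> carrier (free_group S)"
    by (rule conj_product_closed) (use ps(2) in \<open>auto simp: relations_def\<close>)
  moreover have "free_reduce [] = \<one>\<^bsub>free_group S\<^esub>" by (simp add: free_group_def free_reduce_def)
  ultimately show ?thesis unfolding fills_with_def by auto
qed

text \<open>The relators are all relations of length at most \<open>2 * l\<close>. There are
  finitely many, and since every relation rewrites to the empty word they normally generate the
  kernel.\<close>

lemma (in group) dehn_data_of_chains:
  assumes S: "S \<subseteq> carrier G" "finite S" "\<And>s. s \<in> S \<Longrightarrow> inv s \<in> S"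
    and gen: "\<And>g. g \<in> carrier G \<Longrightarrow> \<exists>w\<in>words S. word_val G w = g"
    and fill: "\<And>w. w \<in> relations G S \<Longrightarrow> \<exists>m. chain (short_eq G S l) m w []"
  shows "dehn_data G S (2 * l)" "finitely_presented G"
proof -
  interpret F: group "free_group S" by (rule group_free_group)
  interpret h: group_hom "free_group S" G "word_val G"
    using word_val_hom[OF S(1)] by unfold_locales
  let ?R = "{w \<in> relations G S. length w \<le> 2 * l}"
  let ?N = "normal_closure (free_group S) (free_reduce ` ?R)"
  have fin: "finite ?R"
    using finite_relations_le[OF S(2), of G "real (2 * l)"] by (simp only: of_nat_le_iff)
  have RF: "free_reduce ` ?R \<subseteq> carrier (free_group S)"
    by (auto simp: relations_def intro: free_reduce_in_free_group)
  interpret N: normal ?N "free_group S" by (rule F.normal_normal_closure[OF RF])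
  have "generate G S = carrier G"
  proof
    show "generate G S \<subseteq> carrier G" using S(1) by (rule generate_incl)
    have "w \<in> words S \<Longrightarrow> word_val G w \<in> generate G S" for w
      by (induction w) (auto simp: word_val_Cons intro: generate.intros)
    then show "carrier G \<subseteq> generate G S" using gen by blast
  qed
  moreover have "kernel (free_group S) G (word_val G) = ?N"
  proof
    have C: "{g \<otimes>\<^bsub>free_group S\<^esub> r \<otimes>\<^bsub>free_group S\<^esub> inv\<^bsub>free_group S\<^esub> g | g r.
        g \<in> carrier (free_group S) \<and> r \<in> free_reduce ` ?R} \<subseteq> kernel (free_group S) G (word_val G)"
    proof clarify
      fix g r assume g: "g \<in> carrier (free_group S)" and r: "r \<in> relations G S"
      then have "free_reduce r \<in> carrier (free_group S)" "word_val G (free_reduce r) = \<one>"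
        using word_val_free_reduce[OF S(1)]
        by (auto simp: relations_def intro: free_reduce_in_free_group)
      then show "g \<otimes>\<^bsub>free_group S\<^esub> free_reduce r \<otimes>\<^bsub>free_group S\<^esub> inv\<^bsub>free_group S\<^esub> g
          \<in> kernel (free_group S) G (word_val G)"
        using g by (auto simp: kernel_def)
    qed
    show "?N \<subseteq> kernel (free_group S) G (word_val G)"
      unfolding normal_closure_def
      by (rule F.generate_subgroup_incl[OF C h.subgroup_kernel])
    show "kernel (free_group S) G (word_val G) \<subseteq> ?N"
    proof
      fix w assume w: "w \<in> kernel (free_group S) G (word_val G)"
      then have wS: "w \<in> words S" "reduced w" "w \<in> relations G S"
        by (auto simp: kernel_def free_group_def relations_def)
      obtain m where "chain (short_eq G S l) m w []" using fill wS by blast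
      then have "fills_with G S (2 * l) w m" using chain_fills_with[OF S(1)] wS by blast
      then obtain ps where ps: "w = conj_product S ps"
        "\<forall>(g, r)\<in>set ps. g \<in> carrier (free_group S) \<and> r \<in> relations G S \<and> length r \<le> 2 * l"
        using wS by (auto simp: fills_with_def)
      have "\<forall>(g, r)\<in>set ps. g \<in> carrier (free_group S) \<and> r \<in> relations G S \<and> length r \<le> 2 * l
        \<Longrightarrow> conj_product S ps \<in> ?N"
      proof (induction ps)
        case Nil
        then show ?case by (simp add: conj_product_def)
      next
        case (Cons p ps)
        obtain g r where p: "p = (g, r)" by fastforce
        have "g \<otimes>\<^bsub>free_group S\<^esub> free_reduce r \<otimes>\<^bsub>free_group S\<^esub> inv\<^bsub>free_group S\<^esub> g \<in> ?N"
          unfolding normal_closure_def using Cons.prems p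
          by (intro generate.incl) auto
        then show ?case using Cons p by (simp add: conj_product_def)
      qed
      then show "w \<in> ?N" using ps by blast
    qed
  qed
  ultimately have pres: "presentation G S ?R"
    using S(1) by (auto simp: presentation_def relations_def)
  show "dehn_data G S (2 * l)"
    unfolding dehn_data_def using S pres by blast
  show "finitely_presented G"
    unfolding finitely_presented_def using S(2) pres fin by blast
qed

lemma (in group) area_le_of_chain:
  assumes "S \<subseteq> carrier G" "w \<in> words S" "chain (short_eq G S l) m w []"
  shows "area G S (2 * l) w \<le> m"
  unfolding area_def by (rule Least_le) (rule chain_fills_with[OF assms])

section \<open>Tame actions on products of valued lines\<close>

text \<open>\<open>Digit i x\<close> stands for the element \<open>x\<close> of the copy of the line
  with index \<open>i\<close>, \<open>Step e\<close> for the element \<open>e\<close> of the acting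
  group Z^3.\<close>

datatype 'i gen = Digit 'i rat | Step "int \<times> int \<times> int"

definition unit_steps :: "(int \<times> int \<times> int) set" where
  "unit_steps = {(1, 0, 0), (-1, 0, 0), (0, 1, 0), (0, -1, 0), (0, 0, 1), (0, 0, -1)}"

lemma uminus_unit_steps: "e \<in> unit_steps \<Longrightarrow> - e \<in> unit_steps"
  by (auto simp: unit_steps_def)

fun steps :: "'i gen list \<Rightarrow> (int \<times> int \<times> int) list" where
  "steps [] = []"
| "steps (Digit i x # w) = steps w"
| "steps (Step e # w) = e # steps w"

lemma steps_append [simp]: "steps (u @ w) = steps u @ steps w"
  by (induction u rule: steps.induct) auto

lemma steps_map_Step [simp]: "steps (map Step V) = V"
  by (induction V) auto

lemma length_steps_le: "length (steps w) \<le> length w"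
  by (induction w rule: steps.induct) auto

definition rep :: "nat \<Rightarrow> 'a list \<Rightarrow> 'a list" where
  "rep m V = concat (replicate m V)"

lemma rep_0 [simp]: "rep 0 V = []"
  by (simp add: rep_def)

lemma rep_Suc: "rep (Suc m) V = V @ rep m V"
  by (simp add: rep_def)

lemma rep_Suc_right: "rep (Suc m) V = rep m V @ V"
  by (induction m) (simp_all add: rep_def)

lemma length_rep [simp]: "length (rep m V) = m * length V"
  by (induction m) (simp_all add: rep_def)

lemma set_rep: "set (rep m V) \<subseteq> set V"
  by (auto simp: rep_def)

definition retrace :: "(int \<times> int \<times> int) list \<Rightarrow> (int \<times> int \<times> int) list" where
  "retrace V = rev (map uminus V)"

lemma retrace_rep: "retrace (rep m V) = rep m (retrace V)"
proof (induction m)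
  case (Suc m)
  have "retrace (rep (Suc m) V) = retrace (rep m V) @ retrace V" by (simp add: rep_Suc retrace_def)
  with Suc show ?case by (simp add: rep_Suc_right)
qed (simp add: retrace_def)

lemma length_retrace [simp]: "length (retrace V) = length V"
  by (simp add: retrace_def)

lemma sum_list_retrace [simp]: "sum_list (retrace V) = - sum_list V"
  by (induction V) (simp_all add: retrace_def)

lemma set_retrace: "set V \<subseteq> unit_steps \<Longrightarrow> set (retrace V) \<subseteq> unit_steps"
  unfolding retrace_def set_rev set_map by (blast intro: uminus_unit_steps)

lemma opposite_step_occurs:
  assumes "set V \<subseteq> unit_steps" "e \<in> unit_steps" "sum_list V = - e"
  shows "- e \<in> set V"
proof (rule ccontr)
  assume "- e \<notin> set V"
  \<comment> \<open>The inner product with \<open>e\<close> is negative on \<open>- e\<close> and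
    nonnegative on every other unit step.\<close>
  define f :: "int \<times> int \<times> int \<Rightarrow> int" where
    "f = (\<lambda>(a, b, c). a * fst e + b * fst (snd e) + c * snd (snd e))"
  have f_add: "f (v + w) = f v + f w" for v w
    by (cases v; cases w) (simp add: f_def algebra_simps)
  have f_pos: "f v \<ge> 0" if "v \<in> unit_steps" "v \<noteq> - e" for v
    using that assms(2) by (auto simp: f_def unit_steps_def)
  have "set V \<subseteq> unit_steps \<Longrightarrow> - e \<notin> set V \<Longrightarrow> f (sum_list V) \<ge> 0"
  proof (induction V)
    case (Cons v V)
    then have "f v \<ge> 0" "f (sum_list V) \<ge> 0" by (auto intro: f_pos)
    then show ?case by (simp add: f_add)
  qed (simp add: f_def zero_prod_def)
  with assms(1) \<open>- e \<notin> set V\<close> have "f (sum_list V) \<ge> 0" by blast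
  moreover have "f (- e) < 0" using assms(2) by (auto simp: f_def unit_steps_def)
  ultimately show False using assms(3) by simp
qed

section \<open>Words over digits and steps, evaluated in a semidirect product\<close>

locale digit_system =
  fixes U :: "'i \<Rightarrow> rat set"
    and \<phi> :: "int \<times> int \<times> int \<Rightarrow> rat"
  assumes phi_0 [simp]: "\<phi> 0 = 1"
    and phi_add: "\<phi> (v + w) = \<phi> v * \<phi> w"
    and zero_digit: "0 \<in> U i"
begin

lemma phi_uminus_mult [simp]: "\<phi> v * \<phi> (- v) = 1" "\<phi> (- v) * \<phi> v = 1"
  using phi_add[of v "- v"] phi_add[of "- v" v] by simp_all

lemma phi_nonzero [simp]: "\<phi> v \<noteq> 0"
  using phi_uminus_mult(1)[of v] by (metis mult_zero_left zero_neq_one)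

lemma phi_uminus: "\<phi> (- v) = 1 / \<phi> v"
  using phi_uminus_mult(2)[of v] by (simp add: field_simps)

text \<open>Together with \<open>sum_list (steps w)\<close> this evaluates a word in the semidirect
  product of a power of the rationals with Z^3, which acts on every copy through the character
  \<open>\<phi>\<close>; \<open>coord_append\<close> is the multiplication law. The sets
  \<open>U i\<close> play the role of unit balls.\<close>

fun coord :: "'i \<Rightarrow> 'i gen list \<Rightarrow> rat" where
  "coord i [] = 0"
| "coord i (Digit j x # w) = (if j = i then x else 0) + coord i w"
| "coord i (Step e # w) = \<phi> e * coord i w"

lemma coord_append [simp]: "coord i (u @ w) = coord i u + \<phi> (sum_list (steps u)) * coord i w"
  by (induction i u rule: coord.induct) (auto simp: phi_add algebra_simps)

lemma coord_map_Step [simp]: "coord i (map Step V) = 0"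
  by (induction V) auto

lemma phi_sum_rep: "\<phi> (sum_list (rep m V)) = \<phi> (sum_list V) ^ m"
  by (induction m) (auto simp: rep_Suc phi_add)

fun gen_ok :: "'i gen \<Rightarrow> bool" where
  "gen_ok (Digit i x) \<longleftrightarrow> x \<in> U i"
| "gen_ok (Step e) \<longleftrightarrow> e \<in> unit_steps"

definition ok :: "'i gen list \<Rightarrow> bool" where
  "ok w \<longleftrightarrow> list_all gen_ok w"

lemma ok_simps [simp]:
  "ok []" "ok (x # w) \<longleftrightarrow> gen_ok x \<and> ok w" "ok (u @ w) \<longleftrightarrow> ok u \<and> ok w"
  by (simp_all add: ok_def)

lemma ok_map_Step: "ok (map Step V) \<longleftrightarrow> set V \<subseteq> unit_steps"
  by (induction V) auto

lemma steps_ok: "ok w \<Longrightarrow> set (steps w) \<subseteq> unit_steps"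
  by (induction w rule: steps.induct) auto

text \<open>The bound 40 has no meaning beyond accommodating the longest rewriting step needed.\<close>

definition rel :: "'i gen list \<Rightarrow> 'i gen list \<Rightarrow> bool" where
  "rel a b \<longleftrightarrow> ok a \<and> ok b \<and> length a \<le> 40 \<and> length b \<le> 40 \<and>
     sum_list (steps a) = sum_list (steps b) \<and> (\<forall>i. coord i a = coord i b)"

lemma rel_sym: "rel a b \<Longrightarrow> rel b a"
  by (auto simp: rel_def)

abbreviation homot :: "nat \<Rightarrow> 'i gen list \<Rightarrow> 'i gen list \<Rightarrow> bool" where
  "homot \<equiv> chain rel"

lemma homot_sym: "homot m u v \<Longrightarrow> homot m v u"
  by (rule chain_sym[OF rel_sym])

section \<open>Blocks: large digits as conjugates of unit digits\<close>

definition expands :: "(int \<times> int \<times> int) list \<Rightarrow> 'i \<Rightarrow> bool" where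
  "expands V i \<longleftrightarrow> set V \<subseteq> unit_steps \<and> length V \<le> 5 \<and>
     (\<forall>x\<in>U i. \<forall>y\<in>U i. (x + y) / \<phi> (sum_list V) \<in> U i) \<and>
     (\<forall>e\<in>unit_steps. \<forall>x\<in>U i. \<phi> e * x / \<phi> (sum_list V) \<in> U i)"

definition level :: "(int \<times> int \<times> int) list \<Rightarrow> 'i \<Rightarrow> nat \<Rightarrow> rat \<Rightarrow> bool" where
  "level V i m x \<longleftrightarrow> x / \<phi> (sum_list V) ^ m \<in> U i"

text \<open>The element \<open>x\<close> of the copy \<open>i\<close>, written as
  \<open>V^m u V^-m\<close>; if \<open>x\<close> has level \<open>m\<close>, then \<open>u\<close>
  lies in the unit ball. The length is linear in \<open>m\<close>, although \<open>x\<close> may be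
  exponentially large.\<close>

definition block :: "(int \<times> int \<times> int) list \<Rightarrow> 'i \<Rightarrow> nat \<Rightarrow> rat \<Rightarrow> 'i gen list" where
  "block V i m x =
     map Step (rep m V) @ [Digit i (x / \<phi> (sum_list V) ^ m)] @ map Step (rep m (retrace V))"

text \<open>The purpose of \<open>expands\<close>: one more application of \<open>V\<close> absorbs
  a sum of two elements, and in \<open>level_phi\<close> the action of a unit step.\<close>

lemma level_add:
  assumes "expands V i" "level V i m x" "level V i m y"
  shows "level V i (Suc m) (x + y)"
proof -
  have "(x / \<phi> (sum_list V) ^ m + y / \<phi> (sum_list V) ^ m) / \<phi> (sum_list V) \<in> U i"
    using assms by (auto simp: expands_def level_def)
  moreover have "(x / \<phi> (sum_list V) ^ m + y / \<phi> (sum_list V) ^ m) / \<phi> (sum_list V)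
      = (x + y) / \<phi> (sum_list V) ^ Suc m"
    by (simp add: field_simps)
  ultimately show ?thesis by (simp add: level_def)
qed

lemma level_phi:
  assumes "expands V i" "e \<in> unit_steps" "level V i m x"
  shows "level V i (Suc m) (\<phi> e * x)"
proof -
  have "\<phi> e * (x / \<phi> (sum_list V) ^ m) / \<phi> (sum_list V) \<in> U i"
    using assms unfolding expands_def level_def by blast
  then show ?thesis by (simp add: level_def field_simps)
qed

lemma level_0 [simp]: "level V i m 0"
  by (simp add: level_def zero_digit)

lemma level_mono:
  assumes "expands V i" "level V i m x" "m \<le> m'"
  shows "level V i m' x"
  using assms(3,2)
proof (induction rule: dec_induct)
  case (step k)
  then show ?case using level_add[OF assms(1), of k x 0] by simp
qed

text \<open>Each letter performs one addition or one unit step and therefore raises the level by at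
  most one.\<close>

lemma level_coord:
  assumes "expands V i"
  shows "ok w \<Longrightarrow> level V i (length w) (coord i w)"
proof (induction w)
  case (Cons g w)
  show ?case
  proof (cases g)
    case (Digit j x)
    have "level V i (length w) (if j = i then x else 0)"
      using Cons.prems Digit level_mono[OF assms, of 0 x "length w"] by (auto simp: level_def zero_digit)
    then show ?thesis using Cons Digit level_add[OF assms] by auto
  next
    case (Step e)
    then show ?thesis using Cons level_phi[OF assms] by auto
  qed
qed simp

lemma level_phi_list:
  assumes "expands V i" "set W \<subseteq> unit_steps" "level V i m x"
  shows "level V i (length W + m) (\<phi> (sum_list W) * x)"
  using assms(2)
proof (induction W)
  case (Cons e W)
  then show ?case using level_phi[OF assms(1), of e "length W + m" "\<phi> (sum_list W) * x"]
    by (simp add: phi_add mult.assoc)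
qed (simp add: assms(3))

lemma ok_block: "expands V i \<Longrightarrow> level V i m x \<Longrightarrow> ok (block V i m x)"
  using set_rep[of m V] set_rep[of m "retrace V"] set_retrace[of V]
  by (auto simp: block_def ok_map_Step expands_def level_def)

lemma block_eq:
  "block V i m x = map Step (rep m V) @ [Digit i (x / \<phi> (sum_list V) ^ m)] @ map Step (retrace (rep m V))"
  by (simp add: block_def retrace_rep)

text \<open>Only the digit in the middle is touched: it is itself rewritten as a conjugate by
  \<open>V\<close>.\<close>

lemma block_raise1:
  assumes "expands V i" "level V i m x"
  shows "homot 1 (block V i m x) (block V i (Suc m) x)"
proof -
  let ?p = "\<phi> (sum_list V)"
  have *: "level V i (Suc m) x" by (rule level_mono[OF assms]) simp
  have "rel [Digit i (x / ?p ^ m)] (map Step V @ [Digit i (x / ?p ^ Suc m)] @ map Step (retrace V))"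
    using assms * set_retrace by (auto simp: rel_def expands_def ok_map_Step level_def)
  then have "homot 1 (map Step (rep m V) @ [Digit i (x / ?p ^ m)] @ map Step (rep m (retrace V)))
      (map Step (rep m V) @ (map Step V @ [Digit i (x / ?p ^ Suc m)] @ map Step (retrace V))
        @ map Step (rep m (retrace V)))"
    unfolding One_nat_def by (intro chain_context chain_one)
  then show ?thesis by (simp add: block_def rep_Suc_right[of m V] rep_Suc[of m "retrace V"])
qed

lemma block_raise:
  assumes "expands V i" "level V i m x" "m \<le> m'"
  shows "homot (m' - m) (block V i m x) (block V i m' x)"
  using assms(3)
proof (induction rule: dec_induct)
  case base
  then show ?case by (simp add: chain.chain_refl)
next
  case (step k)
  have "level V i k x" by (rule level_mono[OF assms(1,2) step.hyps(1)])
  from chain_trans[OF step.IH block_raise1[OF assms(1) this]] step.hyps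
  show ?case by (simp add: Suc_diff_le)
qed

lemma steps_commute:
  assumes "set V \<subseteq> unit_steps" "set W \<subseteq> unit_steps" "length V + length W \<le> 40"
  shows "homot m (map Step V @ map Step (rep m W)) (map Step (rep m W) @ map Step V)"
proof (induction m)
  case 0
  then show ?case by (simp add: chain.chain_refl)
next
  case (Suc m)
  have "rel (map Step V @ map Step W) (map Step W @ map Step V)"
    using assms by (auto simp: rel_def ok_map_Step add.commute)
  then have 1: "homot (Suc 0) ((map Step V @ map Step W) @ map Step (rep m W))
      ((map Step W @ map Step V) @ map Step (rep m W))"
    by (intro chain_append_right chain_one)
  have 2: "homot m (map Step W @ map Step V @ map Step (rep m W)) (map Step W @ map Step (rep m W) @ map Step V)"
    by (intro chain_append_left Suc.IH)
  show ?case using chain_trans[OF 1] 2 by (simp add: rep_Suc)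
qed

text \<open>The letter \<open>e\<close> passes \<open>V^m\<close> and \<open>V^-m\<close> by
  \<open>m\<close> commutations each. In between, one relation multiplies the digit by
  \<open>\<phi> e\<close> and pays for it with one more level.\<close>

lemma step_block:
  assumes V: "expands V i" and e: "e \<in> unit_steps" and l: "level V i m x"
  shows "homot (2 * m + 1) (Step e # block V i m x) (block V i (Suc m) (\<phi> e * x) @ [Step e])"
proof -
  let ?p = "\<phi> (sum_list V)" and ?A = "map Step (rep m V)" and ?B = "map Step (rep m (retrace V))"
  have sV: "set V \<subseteq> unit_steps" "length V \<le> 5" using V by (auto simp: expands_def)
  have 1: "homot m ([Step e] @ ?A) (?A @ [Step e])"
    using steps_commute[of "[e]" V m] sV e by simp
  have l': "level V i (Suc m) (\<phi> e * x)" by (rule level_phi[OF V e l])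
  have 2: "rel [Step e, Digit i (x / ?p ^ m)]
      (map Step V @ [Digit i (\<phi> e * x / ?p ^ Suc m)] @ map Step (retrace V) @ [Step e])"
    using sV e l l' set_retrace[of V] by (auto simp: rel_def ok_map_Step level_def)
  have 3: "homot m ([Step e] @ ?B) (?B @ [Step e])"
    using steps_commute[of "[e]" "retrace V" m] sV e set_retrace[of V] by simp
  have a: "homot m (Step e # block V i m x) (?A @ [Step e, Digit i (x / ?p ^ m)] @ ?B)"
    using chain_append_right[OF 1, of "[Digit i (x / ?p ^ m)] @ ?B"] by (simp add: block_def)
  have b: "homot (Suc 0) (?A @ [Step e, Digit i (x / ?p ^ m)] @ ?B)
    (?A @ (map Step V @ [Digit i (\<phi> e * x / ?p ^ Suc m)] @ map Step (retrace V) @ [Step e]) @ ?B)"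
    by (intro chain_context chain_one 2)
  have c: "homot m (?A @ (map Step V @ [Digit i (\<phi> e * x / ?p ^ Suc m)] @ map Step (retrace V) @ [Step e]) @ ?B)
    (block V i (Suc m) (\<phi> e * x) @ [Step e])"
    using chain_append_left[OF 3, of "?A @ map Step V @ [Digit i (\<phi> e * x / ?p ^ Suc m)] @ map Step (retrace V)"]
    by (simp add: block_def rep_Suc_right[of m V] rep_Suc[of m "retrace V"])
  show ?thesis
    by (rule chain_mono[OF chain_trans[OF chain_trans[OF a b] c]]) simp
qed

lemma steps_block:
  assumes V: "expands V i" and l: "level V i m x"
  shows "set W \<subseteq> unit_steps \<Longrightarrow> homot (length W * (2 * (length W + m)))
    (map Step W @ block V i m x) (block V i (length W + m) (\<phi> (sum_list W) * x) @ map Step W)"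
proof (induction W)
  case Nil
  then show ?case by (simp add: chain.chain_refl)
next
  case (Cons e W)
  then have W: "set W \<subseteq> unit_steps" and e: "e \<in> unit_steps" by auto
  let ?k = "length W + m"
  have 1: "homot (length W * (2 * ?k)) ([Step e] @ map Step W @ block V i m x)
      ([Step e] @ block V i ?k (\<phi> (sum_list W) * x) @ map Step W)"
    by (intro chain_append_left Cons.IH W)
  have 2: "homot (2 * ?k + 1) ([Step e] @ block V i ?k (\<phi> (sum_list W) * x) @ map Step W)
     (block V i (Suc ?k) (\<phi> e * (\<phi> (sum_list W) * x)) @ [Step e] @ map Step W)"
    using chain_append_right[OF step_block[OF V e level_phi_list[OF V W l]], of "map Step W"] by simp
  have "homot (length W * (2 * ?k) + (2 * ?k + 1)) (map Step (e # W) @ block V i m x)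
      (block V i (length (e # W) + m) (\<phi> (sum_list (e # W)) * x) @ map Step (e # W))"
    using chain_trans[OF 1 2] by (simp add: phi_add mult.assoc)
  then show ?case by (rule chain_mono) (simp add: algebra_simps)
qed

lemma steps_cancel:
  "set W \<subseteq> unit_steps \<Longrightarrow> homot (length W) (map Step W @ map Step (retrace W)) []"
proof (induction W)
  case Nil
  then show ?case by (simp add: retrace_def chain.chain_refl)
next
  case (Cons e W)
  have 1: "homot (length W) ([Step e] @ (map Step W @ map Step (retrace W)) @ [Step (- e)]) ([Step e] @ [] @ [Step (- e)])"
    using Cons by (intro chain_context) auto
  have "rel [Step e, Step (- e)] []"
    using Cons.prems uminus_unit_steps by (auto simp: rel_def)
  then have 2: "homot (Suc 0) [Step e, Step (- e)] []" by (rule chain_one)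
  have "homot (length W + Suc 0) ([Step e] @ (map Step W @ map Step (retrace W)) @ [Step (- e)]) []"
    by (rule chain_trans[OF 1]) (use 2 in simp)
  then show ?case by (simp add: retrace_def)
qed

text \<open>The word \<open>A = V^m\<close> is dragged through the level-zero block of the digit in
  direction \<open>W\<close>. This raises the level by \<open>length A\<close>, after which
  \<open>A\<close> cancels against its inverse. The factor 5 is the length bound for
  \<open>V\<close>.\<close>

lemma block_change:
  assumes V: "expands V i" and W: "expands W i" and l: "level V i m x"
  shows "level W i (5 * m) x" "homot (50 * m * m + 10 * m) (block V i m x) (block W i (5 * m) x)"
proof -
  define A where "A = rep m V"
  let ?u = "x / \<phi> (sum_list V) ^ m"
  have A: "set A \<subseteq> unit_steps" "length A \<le> 5 * m"
    using V set_rep[of m V] by (auto simp: A_def expands_def)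
  have x: "\<phi> (sum_list A) * ?u = x" by (simp add: A_def phi_sum_rep)
  have u: "level W i 0 ?u" using l by (simp add: level_def)
  have lA: "level W i (length A) x"
    using level_phi_list[OF W A(1) u] x by simp
  then show "level W i (5 * m) x" by (rule level_mono[OF W]) (rule A)
  have "homot (length A * (2 * (length A + 0)))
    (map Step A @ block W i 0 ?u) (block W i (length A + 0) (\<phi> (sum_list A) * ?u) @ map Step A)"
    by (rule steps_block[OF W u A(1)])
  then have "homot (length A * (2 * length A)) (map Step A @ [Digit i ?u]) (block W i (length A) x @ map Step A)"
    unfolding x by (simp add: block_def)
  from chain_append_right[OF this, of "map Step (retrace A)"]
  have 1: "homot (length A * (2 * length A)) (block V i m x)
      (block W i (length A) x @ map Step A @ map Step (retrace A))"
    by (simp add: block_eq A_def)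
  have 2: "homot (length A) (block W i (length A) x @ map Step A @ map Step (retrace A)) (block W i (length A) x @ [])"
    by (intro chain_append_left steps_cancel A)
  have 3: "homot (5 * m - length A) (block W i (length A) x @ []) (block W i (5 * m) x)"
    using block_raise[OF W lA A(2)] by simp
  have "length A * (2 * length A) \<le> 50 * m * m"
    using mult_mono[OF A(2) mult_mono[OF order_refl[of 2] A(2)]] by simp
  then show "homot (50 * m * m + 10 * m) (block V i m x) (block W i (5 * m) x)"
    using A(2) by (intro chain_mono[OF chain_trans[OF chain_trans[OF 1 2] 3]]) simp
qed

text \<open>For a common direction the inner \<open>W^-m W^m\<close> cancels from the middle
  outwards, and the two digits become neighbours.\<close>

lemma blocks_meet:
  assumes i: "expands W i" "level W i m x" and j: "expands W j" "level W j m y"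
  shows "homot m (block W i m x @ block W j m y) (map Step (rep m W)
     @ [Digit i (x / \<phi> (sum_list W) ^ m), Digit j (y / \<phi> (sum_list W) ^ m)] @ map Step (rep m (retrace W)))"
proof -
  have W: "set W \<subseteq> unit_steps" "length W \<le> 5" using i by (auto simp: expands_def)
  have "homot k (map Step (rep k (retrace W)) @ map Step (rep k W)) []" for k
  proof (induction k)
    case 0
    then show ?case by (simp add: chain.chain_refl)
  next
    case (Suc k)
    have "rel (map Step (retrace W) @ map Step W) []"
      using W set_retrace[of W] by (auto simp: rel_def ok_map_Step)
    then have "homot (Suc 0) (map Step (rep k (retrace W)) @ (map Step (retrace W) @ map Step W) @ map Step (rep k W))
        (map Step (rep k (retrace W)) @ [] @ map Step (rep k W))"
      by (intro chain_context chain_one)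
    from chain_trans[OF this, of k "[]"] Suc.IH show ?case
      by (simp add: rep_Suc_right[of k "retrace W"] rep_Suc[of k W])
  qed
  from chain_context[OF this[of m], of "map Step (rep m W) @ [Digit i (x / \<phi> (sum_list W) ^ m)]"
      "[Digit j (y / \<phi> (sum_list W) ^ m)] @ map Step (rep m (retrace W))"]
  show ?thesis by (simp add: block_def)
qed

lemma block_add:
  assumes V: "expands V i" and l: "level V i m x" "level V i m y"
  shows "homot (m + 1) (block V i m x @ block V i m y) (block V i (Suc m) (x + y))"
proof -
  let ?p = "\<phi> (sum_list V)"
  have sV: "set V \<subseteq> unit_steps" "length V \<le> 5" using V by (auto simp: expands_def)
  have "level V i (Suc m) (x + y)" by (rule level_add[OF V l])
  then have "rel [Digit i (x / ?p ^ m), Digit i (y / ?p ^ m)]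
    (map Step V @ [Digit i ((x + y) / ?p ^ Suc m)] @ map Step (retrace V))"
    using l sV set_retrace[of V] by (auto simp: rel_def ok_map_Step level_def field_simps)
  then have "homot (Suc 0) (map Step (rep m V) @ [Digit i (x / ?p ^ m), Digit i (y / ?p ^ m)] @ map Step (rep m (retrace V)))
    (map Step (rep m V) @ (map Step V @ [Digit i ((x + y) / ?p ^ Suc m)] @ map Step (retrace V)) @ map Step (rep m (retrace V)))"
    by (intro chain_context chain_one)
  from chain_trans[OF blocks_meet[OF V l(1) V l(2)] this] show ?thesis
    by (simp add: block_def rep_Suc_right[of m V] rep_Suc[of m "retrace V"])
qed

text \<open>This is where a direction \<open>Z\<close> expanding both copies is decisive: once both
  blocks are conjugated by the same word, their digits become neighbours and commute by a single
  relation.\<close>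

lemma block_commute:
  assumes V: "expands V i" "level V i m x" and W: "expands W j" "level W j m y"
    and Z: "expands Z i" "expands Z j"
  shows "homot (200 * m * m + 50 * m + 1) (block V i m x @ block W j m y) (block W j m y @ block V i m x)"
proof -
  let ?c = "50 * m * m + 10 * m" and ?p = "\<phi> (sum_list Z) ^ (5 * m)"
  note x = block_change[OF V(1) Z(1) V(2)]
  note y = block_change[OF W(1) Z(2) W(2)]
  have 1: "homot (?c + ?c) (block V i m x @ block W j m y) (block Z i (5 * m) x @ block Z j (5 * m) y)"
    by (rule chain_append[OF x(2) y(2)])
  have ends: "homot (?c + ?c) (block Z j (5 * m) y @ block Z i (5 * m) x) (block W j m y @ block V i m x)"
    by (rule homot_sym[OF chain_append[OF y(2) x(2)]])
  note 2 = blocks_meet[OF Z(1) x(1) Z(2) y(1)]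
  note meet = homot_sym[OF blocks_meet[OF Z(2) y(1) Z(1) x(1)]]
  have "rel [Digit i (x / ?p), Digit j (y / ?p)] [Digit j (y / ?p), Digit i (x / ?p)]"
    using x(1) y(1) by (auto simp: rel_def level_def)
  then have 3: "homot (Suc 0)
     (map Step (rep (5 * m) Z) @ [Digit i (x / ?p), Digit j (y / ?p)] @ map Step (rep (5 * m) (retrace Z)))
     (map Step (rep (5 * m) Z) @ [Digit j (y / ?p), Digit i (x / ?p)] @ map Step (rep (5 * m) (retrace Z)))"
    by (intro chain_context chain_one)
  show ?thesis
    by (rule chain_mono[OF chain_trans[OF chain_trans[OF 1 2] chain_trans[OF 3 chain_trans[OF meet ends]]]])
       simp
qed

lemma step_past_steps:
  assumes e: "e \<in> unit_steps"
  shows "set X \<subseteq> unit_steps \<Longrightarrow> homot (length X) (Step e # map Step X) (map Step X @ [Step e])"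
proof (induction X)
  case Nil
  then show ?case by (simp add: chain.chain_refl)
next
  case (Cons f X)
  have "rel [Step e, Step f] [Step f, Step e]"
    using Cons.prems e by (auto simp: rel_def add.commute)
  then have 1: "homot (Suc 0) ([Step e, Step f] @ map Step X) ([Step f, Step e] @ map Step X)"
    by (intro chain_append_right chain_one)
  have "homot (length X) ([Step f] @ Step e # map Step X) ([Step f] @ map Step X @ [Step e])"
    using Cons by (intro chain_append_left) auto
  with chain_trans[OF 1] show ?case by simp
qed

text \<open>The inverse of the first letter occurs by \<open>opposite_step_occurs\<close>. The first
  letter is moved up to it and cancelled, at linear cost for each cancelled pair.\<close>

lemma steps_trivial:
  "set V \<subseteq> unit_steps \<Longrightarrow> sum_list V = 0 \<Longrightarrow> homot (length V * length V) (map Step V) []"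
proof (induction V rule: length_induct)
  case (1 V)
  show ?case
  proof (cases V)
    case Nil
    then show ?thesis by (simp add: chain.chain_refl)
  next
    case (Cons e W)
    have W: "set W \<subseteq> unit_steps" "e \<in> unit_steps" "sum_list W = - e"
      using "1.prems" Cons by (auto simp: eq_neg_iff_add_eq_0 add.commute)
    then obtain X Y where XY: "W = X @ - e # Y"
      using opposite_step_occurs split_list by metis
    have a: "homot (length X) (Step e # map Step X) (map Step X @ [Step e])"
      using W XY by (intro step_past_steps) auto
    have "rel [Step e, Step (- e)] []" using W(2) uminus_unit_steps by (auto simp: rel_def)
    then have b: "homot (Suc 0) (map Step X @ [Step e, Step (- e)] @ map Step Y) (map Step X @ [] @ map Step Y)"
      by (intro chain_context chain_one)
    have c: "homot (length (X @ Y) * length (X @ Y)) (map Step (X @ Y)) []"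
    proof (rule "1.IH"[rule_format])
      show "sum_list (X @ Y) = 0" using W(3) XY by (simp add: eq_neg_iff_add_eq_0 algebra_simps)
    qed (use W XY Cons in auto)
    have a': "homot (length X) (map Step V) (map Step X @ [Step e, Step (- e)] @ map Step Y)"
      using chain_append_right[OF a, of "map Step (- e # Y)"] by (simp add: Cons XY)
    have "homot (length X + (Suc 0 + length (X @ Y) * length (X @ Y))) (map Step V) []"
      by (rule chain_trans[OF a' chain_trans[OF b]]) (use c in simp)
    then show ?thesis by (rule chain_mono) (simp add: Cons XY algebra_simps)
  qed
qed

end

section \<open>Normal forms over three copies and quadratic fillings\<close>

locale tame_system = digit_system U \<phi> for U :: "'i \<Rightarrow> rat set" and \<phi> +
  fixes zeta :: "'i \<Rightarrow> 'i \<Rightarrow> (int \<times> int \<times> int) list" and cs :: "'i list"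
  assumes zeta: "expands (zeta i j) i" "expands (zeta i j) j"
    and cs: "distinct cs" "set cs = UNIV" "length cs = 3"
begin

text \<open>Each copy has a standard direction \<open>zeta i i\<close>; the mixed directions serve
  to commute blocks of different copies in \<open>blocks_past_block\<close>.\<close>

abbreviation lev :: "'i \<Rightarrow> nat \<Rightarrow> rat \<Rightarrow> bool" where
  "lev i \<equiv> level (zeta i i) i"

abbreviation blk :: "'i \<Rightarrow> nat \<Rightarrow> rat \<Rightarrow> 'i gen list" where
  "blk i \<equiv> block (zeta i i) i"

definition blocks :: "'i list \<Rightarrow> nat \<Rightarrow> ('i \<Rightarrow> rat) \<Rightarrow> 'i gen list" where
  "blocks is m a = concat (map (\<lambda>i. blk i m (a i)) is)"

lemma blocks_Nil [simp]: "blocks [] m a = []"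
  by (simp add: blocks_def)

lemma blocks_Cons [simp]: "blocks (i # is) m a = blk i m (a i) @ blocks is m a"
  by (simp add: blocks_def)

lemma blocks_raise:
  assumes "\<And>i. lev i m (a i)" "m \<le> m'"
  shows "homot (length is * (m' - m)) (blocks is m a) (blocks is m' a)"
proof (induction "is")
  case Nil
  then show ?case by (simp add: chain.chain_refl)
next
  case (Cons i "is")
  then show ?case
    using chain_append[OF block_raise[OF zeta(1) assms] Cons.IH] by simp
qed

lemma steps_blocks:
  assumes l: "\<And>i. lev i m (a i)" and W: "set W \<subseteq> unit_steps"
  shows "homot (length is * (length W * (2 * (length W + m)))) (map Step W @ blocks is m a)
     (blocks is (length W + m) (\<lambda>i. \<phi> (sum_list W) * a i) @ map Step W)"
proof (induction "is")
  case Nil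
  then show ?case by (simp add: chain.chain_refl)
next
  case (Cons i "is")
  let ?k = "length W + m"
  have 1: "homot (length W * (2 * ?k)) (map Step W @ blk i m (a i) @ blocks is m a)
      (blk i ?k (\<phi> (sum_list W) * a i) @ map Step W @ blocks is m a)"
    using chain_append_right[OF steps_block[OF zeta(1) l W], where y = "blocks is m a"] by simp
  have 2: "homot (length is * (length W * (2 * ?k)))
      (blk i ?k (\<phi> (sum_list W) * a i) @ map Step W @ blocks is m a)
      (blk i ?k (\<phi> (sum_list W) * a i) @ blocks is ?k (\<lambda>i. \<phi> (sum_list W) * a i) @ map Step W)"
    by (rule chain_append_left[OF Cons.IH])
  show ?case using chain_trans[OF 1 2] by simp
qed

lemma blocks_past_block:
  assumes l: "\<And>i. lev i m (a i)" "lev j m y"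
  shows "homot (length is * (200 * m * m + 50 * m + 1)) (blocks is m a @ blk j m y) (blk j m y @ blocks is m a)"
proof (induction "is")
  case Nil
  then show ?case by (simp add: chain.chain_refl)
next
  case (Cons i "is")
  let ?c = "200 * m * m + 50 * m + 1"
  have 1: "homot (length is * ?c) (blk i m (a i) @ blocks is m a @ blk j m y)
      (blk i m (a i) @ blk j m y @ blocks is m a)"
    by (rule chain_append_left[OF Cons.IH])
  have 2: "homot ?c (blk i m (a i) @ blk j m y @ blocks is m a) (blk j m y @ blk i m (a i) @ blocks is m a)"
    using chain_append_right[OF block_commute[OF zeta(1) l(1) zeta(1) l(2) zeta(1)[of i j] zeta(2)],
        where y = "blocks is m a"] by simp
  have "homot (length is * ?c + ?c) (blocks (i # is) m a @ blk j m y) (blk j m y @ blocks (i # is) m a)"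
    using chain_trans[OF 1 2] by simp
  then show ?case by (rule chain_mono) simp
qed

text \<open>The first block of the second group is pulled left through the tail of the first group
  and merged with its partner; the tails follow by induction.\<close>

lemma blocks_add:
  assumes l: "\<And>i. lev i m (a i)" "\<And>i. lev i m (b i)"
  shows "homot (length is * (length is * (200 * m * m + 50 * m + 1) + m + 1))
     (blocks is m a @ blocks is m b) (blocks is (Suc m) (\<lambda>i. a i + b i))"
proof (induction "is")
  case Nil
  then show ?case by (simp add: chain.chain_refl)
next
  case (Cons i "is")
  define c where "c = 200 * m * m + 50 * m + 1"
  have 1: "homot (length is * c) (blk i m (a i) @ (blocks is m a @ blk i m (b i)) @ blocks is m b)
      (blk i m (a i) @ (blk i m (b i) @ blocks is m a) @ blocks is m b)"
    unfolding c_def by (intro chain_context blocks_past_block l)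
  have 2: "homot ((m + 1) + (length is * (length is * c + m + 1)))
      ((blk i m (a i) @ blk i m (b i)) @ (blocks is m a @ blocks is m b))
      (blk i (Suc m) (a i + b i) @ blocks is (Suc m) (\<lambda>i. a i + b i))"
    unfolding c_def by (intro chain_append Cons.IH block_add zeta(1) l)
  have "homot (length is * c + ((m + 1) + (length is * (length is * c + m + 1))))
      (blocks (i # is) m a @ blocks (i # is) m b) (blocks (i # is) (Suc m) (\<lambda>i. a i + b i))"
    using chain_trans[OF 1 2[unfolded append_assoc, folded append_assoc[of "blk i m (b i)"]]] by simp
  then show ?case unfolding c_def[symmetric] by (rule chain_mono) (simp add: algebra_simps)
qed

lemma sum_steps_blk [simp]: "sum_list (steps (blk i m x)) = 0"
  using sum_list_retrace[of "rep m (zeta i i)"] by (simp add: block_eq)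

lemma coord_blk [simp]: "coord k (blk i m x) = (if i = k then x else 0)"
  by (simp add: block_eq phi_sum_rep)

lemma sum_steps_blocks [simp]: "sum_list (steps (blocks is m a)) = 0"
  by (induction "is") auto

lemma coord_blocks: "distinct is \<Longrightarrow> coord k (blocks is m a) = (if k \<in> set is then a k else 0)"
  by (induction "is") auto

lemma ok_blocks: "(\<And>i. lev i m (a i)) \<Longrightarrow> ok (blocks is m a)"
  by (induction "is") (auto intro: ok_block zeta)

lemma length_blocks_1: "length (blocks is 1 a) \<le> 11 * length is"
proof (induction "is")
  case (Cons i "is")
  have "length (zeta i i) \<le> 5" using zeta[of i i] by (auto simp: expands_def)
  then have "length (blk i 1 (a i)) \<le> 11" by (simp add: block_def)
  with Cons show ?case by simp
qed simp

lemma lev_coord: "ok w \<Longrightarrow> length w \<le> m \<Longrightarrow> lev i m (coord i w)"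
  by (rule level_mono[OF zeta(1) level_coord[OF zeta(1)]])

text \<open>Divide and conquer: joining the normal forms of the two halves costs quadratically much,
  and the costs at all scales sum up to a geometric series.\<close>

lemma normal_form:
  "ok w \<Longrightarrow> length w \<le> 2 ^ k \<Longrightarrow>
     homot (9000 * 4 ^ k) w (blocks cs (2 ^ k) (\<lambda>i. coord i w) @ map Step (steps w))"
proof (induction k arbitrary: w)
  \<comment> \<open>A word of at most one letter and its normal form, of at most
    \<open>3 * 11 + 1\<close> letters, are short enough to be exchanged by one replacement.\<close>
  case 0
  have l: "lev i 1 (coord i w)" for i using lev_coord 0 by simp
  have "length (steps w) \<le> 1" using length_steps_le[of w] 0 by simp
  then have "length (blocks cs 1 (\<lambda>i. coord i w) @ map Step (steps w)) \<le> 40"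
    using length_blocks_1[of cs "\<lambda>i. coord i w"] cs(3) by simp
  moreover have "ok (map Step (steps w))" using steps_ok 0 by (simp add: ok_map_Step)
  ultimately have "rel w (blocks cs 1 (\<lambda>i. coord i w) @ map Step (steps w))"
    using 0 l cs by (simp add: rel_def ok_blocks coord_blocks)
  then show ?case by (intro chain_mono[OF chain_one]) auto
next
  case (Suc k)
  define N :: nat where "N = 2 ^ k"
  define u v where "u = take N w" and "v = drop N w"
  have w: "w = u @ v" and len: "length u \<le> N" "length v \<le> N"
    using Suc.prems by (auto simp: u_def v_def N_def)
  have oku: "ok u" "ok v" using Suc.prems w by auto
  define a b where "a = (\<lambda>i. coord i u)" and "b = (\<lambda>i. coord i v)"
  define p V W where "p = \<phi> (sum_list (steps u))" and "V = steps u" and "W = steps v"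
  have V: "set V \<subseteq> unit_steps" "length V \<le> N"
    using steps_ok[OF oku(1)] length_steps_le[of u] len by (auto simp: V_def)
  have aN: "lev i N (a i)" and bN: "lev i N (b i)" for i
    using oku len lev_coord by (auto simp: a_def b_def)
  have a2: "lev i (2 * N) (a i)" for i by (rule level_mono[OF zeta(1) aN]) simp
  have pb: "lev i (length V + N) (p * b i)" for i
    using level_phi_list[OF zeta(1) V(1) bN] by (simp add: p_def V_def)
  have pb2: "lev i (2 * N) (p * b i)" for i
    by (rule level_mono[OF zeta(1) pb]) (use V in simp)
  \<comment> \<open>The addition below produces level \<open>2 * N + 1\<close>. The sum is however a
    coordinate of \<open>w\<close>, whose length is at most \<open>2 * N\<close>, so the level can
    be lowered again to match the claim.\<close>
  have c2: "lev i (2 * N) (a i + p * b i)" for i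
    using lev_coord[of w "2 * N"] Suc.prems
    by (simp add: w a_def b_def p_def N_def)
  let ?a = "blocks cs N a" and ?A = "blocks cs (2 * N) a"
  let ?b = "blocks cs N b" and ?B = "blocks cs (2 * N) (\<lambda>i. p * b i)"
  \<comment> \<open>Three stages: both halves are normalised, then the steps \<open>V\<close> of the
    first half pass the blocks of the second, and finally blocks of the same copy are added.\<close>
  have 1: "homot (9000 * 4 ^ k + 9000 * 4 ^ k) w ((?a @ map Step V) @ (?b @ map Step W))"
    unfolding w using Suc.IH[OF oku(1)] Suc.IH[OF oku(2)] len
    by (intro chain_append) (simp_all add: a_def b_def V_def W_def N_def)
  have "homot (3 * (length V * (2 * (length V + N)))) (map Step V @ ?b)
      (blocks cs (length V + N) (\<lambda>i. p * b i) @ map Step V)"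
    using steps_blocks[OF bN V(1), of cs] by (simp add: cs(3) p_def V_def)
  then have "homot (12 * (N * N)) (map Step V @ ?b) (blocks cs (length V + N) (\<lambda>i. p * b i) @ map Step V)"
  proof (rule chain_mono)
    have "length V * (2 * (length V + N)) \<le> N * (2 * (N + N))"
      using V(2) by (intro mult_le_mono) auto
    then show "3 * (length V * (2 * (length V + N))) \<le> 12 * (N * N)" by simp
  qed
  moreover have "homot (3 * N) (blocks cs (length V + N) (\<lambda>i. p * b i) @ map Step V) (?B @ map Step V)"
  proof (rule chain_append_right)
    have "homot (3 * (2 * N - (length V + N))) (blocks cs (length V + N) (\<lambda>i. p * b i)) ?B"
      using blocks_raise[OF pb, of "2 * N" cs] V(2) by (simp add: cs(3))
    then show "homot (3 * N) (blocks cs (length V + N) (\<lambda>i. p * b i)) ?B"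
      by (rule chain_mono) simp
  qed
  ultimately have b: "homot (12 * (N * N) + 3 * N) (map Step V @ ?b) (?B @ map Step V)"
    by (rule chain_trans)
  have "homot (3 * N) ?a ?A"
    using blocks_raise[OF aN, of "2 * N" cs] by (simp add: cs(3))
  from chain_append[OF this chain_append_right[OF b, of "map Step W"]]
  have 2: "homot (3 * N + (12 * (N * N) + 3 * N)) ((?a @ map Step V) @ (?b @ map Step W))
      ((?A @ ?B) @ (map Step V @ map Step W))" by simp
  let ?C = "\<lambda>m. blocks cs m (\<lambda>i. a i + p * b i)"
  have "homot (9 * (200 * (2 * N) * (2 * N) + 50 * (2 * N) + 1) + 3 * (2 * N + 1)) (?A @ ?B) (?C (Suc (2 * N)))"
    by (rule chain_mono[OF blocks_add[OF a2 pb2]]) (simp add: cs(3))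
  moreover have "homot 3 (?C (Suc (2 * N))) (?C (2 * N))"
    using blocks_raise[OF c2, of "Suc (2 * N)" cs] by (rule_tac homot_sym) (simp add: cs(3))
  ultimately have "homot (9 * (200 * (2 * N) * (2 * N) + 50 * (2 * N) + 1) + 3 * (2 * N + 1) + 3) (?A @ ?B) (?C (2 * N))"
    by (rule chain_trans)
  from chain_append_right[OF this, of "map Step V @ map Step W"]
  have 3: "homot (9 * (200 * (2 * N) * (2 * N) + 50 * (2 * N) + 1) + 3 * (2 * N + 1) + 3)
      ((?A @ ?B) @ (map Step V @ map Step W)) (?C (2 * N) @ (map Step V @ map Step W))" .
  have NN: "N * N = 4 ^ k" by (simp add: N_def flip: power_mult_distrib)
  have "N \<ge> 1" by (simp add: N_def)
  then have N1: "N \<le> 4 ^ k" "1 \<le> (4::nat) ^ k" by (simp_all flip: NN)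
  have e: "200 * (2 * N) * (2 * N) = 800 * 4 ^ k" by (simp flip: NN)
  \<comment> \<open>The two halves use up half of the budget \<open>9000 * 4 ^ Suc k\<close>; the
    cost of joining them is a smaller multiple of \<open>4 ^ k\<close> and fits into the other
    half.\<close>
  have cost: "9000 * 4 ^ k + 9000 * 4 ^ k + (3 * N + (12 * (N * N) + 3 * N))
      + (9 * (200 * (2 * N) * (2 * N) + 50 * (2 * N) + 1) + 3 * (2 * N + 1) + 3) \<le> 9000 * 4 ^ Suc k"
  proof -
    have "18000 * M + (3 * N + (12 * M + 3 * N)) + (9 * (800 * M + 50 * (2 * N) + 1) + 3 * (2 * N + 1) + 3)
        \<le> 36000 * M" if "N \<le> M" "1 \<le> M" for M using that by simp
    from this[OF N1] show ?thesis unfolding e NN by simp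
  qed
  have "homot (9000 * 4 ^ Suc k) w (?C (2 * N) @ (map Step V @ map Step W))"
    by (rule chain_mono[OF chain_trans[OF chain_trans[OF 1 2] 3] cost])
  then show ?case by (simp add: w a_def b_def p_def V_def W_def N_def)
qed

lemma quadratic_filling:
  assumes "ok w" "sum_list (steps w) = 0" "\<And>i. coord i w = 0"
  shows "homot (40000 * (length w)\<^sup>2) w []"
proof (cases "w = []")
  case True
  then show ?thesis by (simp add: chain.chain_refl)
next
  case False
  then have w1: "length w \<ge> 1" by (cases w) auto
  \<comment> \<open>The power of two \<open>2 ^ k\<close> is taken between \<open>length w\<close>
    and \<open>2 * length w\<close>, so that \<open>4 ^ k\<close> is at most four times the squared
    length.\<close>
  obtain j where "2 ^ j \<le> length w" "length w < 2 ^ (j + 1)"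
    using ex_power_ivl1[of 2 "length w"] w1 by auto
  then obtain k where k: "length w \<le> 2 ^ k" "2 ^ k \<le> 2 * length w"
    by (intro that[of "j + 1"]) auto
  let ?V = "map Step (steps w)"
  have 1: "homot (9000 * 4 ^ k) w (blocks cs (2 ^ k) (\<lambda>i. 0) @ ?V)"
    using normal_form[OF assms(1) k(1)] assms(3) by simp
  \<comment> \<open>All digits are 0, so the blocks can be lowered to level 0, where they are three
    letters that vanish by one relation.\<close>
  have 2: "homot (3 * 2 ^ k) (blocks cs (2 ^ k) (\<lambda>i. 0)) (blocks cs 0 (\<lambda>i. 0))"
    using blocks_raise[of 0 "\<lambda>i. 0" "2 ^ k" cs] by (rule_tac homot_sym) (simp add: cs(3))
  have "length (blocks is 0 (\<lambda>i. 0)) = length is" for "is"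
    by (induction "is") (auto simp: block_def)
  then have "rel (blocks cs 0 (\<lambda>i. 0)) []"
    by (simp add: rel_def ok_blocks coord_blocks cs)
  note 3 = chain_one[of rel, OF this]
  have 4: "homot (length (steps w) * length (steps w)) ?V []"
    by (rule steps_trivial[OF steps_ok[OF assms(1)] assms(2)])
  have 5: "homot (9000 * 4 ^ k + (3 * 2 ^ k + Suc 0 + length (steps w) * length (steps w))) w ([] @ [])"
    by (rule chain_trans[OF 1 chain_append[OF chain_trans[OF 2 3] 4]])
  have "length (steps w) * length (steps w) \<le> length w * length w"
    using length_steps_le[of w] by (intro mult_le_mono)
  moreover have "(4::nat) ^ k = 2 ^ k * 2 ^ k" by (simp flip: power_mult_distrib)
  then have "4 ^ k \<le> 4 * (length w * length w)"
    using mult_le_mono[OF k(2) k(2)] by simp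
  moreover have "length w \<le> length w * length w" "1 \<le> length w * length w" using w1 by simp_all
  moreover have "9000 * K + (3 * t + Suc 0 + s) \<le> 40000 * q"
    if "s \<le> q" "K \<le> 4 * q" "l \<le> q" "1 \<le> q" "t \<le> 2 * l" for K t s q l :: nat
    using that by simp
  ultimately have "9000 * 4 ^ k + (3 * 2 ^ k + Suc 0 + length (steps w) * length (steps w)) \<le> 40000 * (length w)\<^sup>2"
    using k(2) unfolding power2_eq_square by blast
  from chain_mono[OF 5 this] show ?thesis by simp
qed

lemma lev_word:
  assumes "\<And>i. lev i m (a i)" "set V \<subseteq> unit_steps"
  shows "ok (blocks cs m a @ map Step V)" "coord i (blocks cs m a @ map Step V) = a i"
    "sum_list (steps (blocks cs m a @ map Step V)) = sum_list V"
  using assms by (simp_all add: ok_blocks ok_map_Step coord_blocks cs)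

end

section \<open>The group\<close>

definition loc :: "int \<Rightarrow> rat set" where
  "loc r = {x. \<exists>k::nat. x * of_int r ^ k \<in> \<int>}"

lemma Ints_loc: "x \<in> \<int> \<Longrightarrow> x \<in> loc r"
  unfolding loc_def by (auto intro!: exI[of _ 0])

lemma of_int_loc [simp]: "of_int m \<in> loc r" "0 \<in> loc r" "1 \<in> loc r"
  by (auto intro!: Ints_loc)

lemma loc_mult: "x \<in> loc r \<Longrightarrow> y \<in> loc r \<Longrightarrow> x * y \<in> loc r"
proof -
  assume "x \<in> loc r" "y \<in> loc r"
  then obtain k l where "x * of_int r ^ k \<in> \<int>" "y * of_int r ^ l \<in> \<int>" by (auto simp: loc_def)
  then have "(x * of_int r ^ k) * (y * of_int r ^ l) \<in> \<int>" by (rule Ints_mult)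
  then have "x * y * of_int r ^ (k + l) \<in> \<int>" by (simp add: power_add mult_ac)
  then show ?thesis by (auto simp: loc_def)
qed

lemma loc_uminus: "x \<in> loc r \<Longrightarrow> - x \<in> loc r"
  using loc_mult[of "-1" r x] of_int_loc(1)[of "-1" r] by simp

lemma loc_add: "x \<in> loc r \<Longrightarrow> y \<in> loc r \<Longrightarrow> x + y \<in> loc r"
proof -
  assume "x \<in> loc r" "y \<in> loc r"
  then obtain k l where kl: "x * of_int r ^ k \<in> \<int>" "y * of_int r ^ l \<in> \<int>" by (auto simp: loc_def)
  have "(x * of_int r ^ k) * of_int (r ^ l) + (y * of_int r ^ l) * of_int (r ^ k) \<in> \<int>"
    by (rule Ints_add[OF Ints_mult[OF kl(1) Ints_of_int] Ints_mult[OF kl(2) Ints_of_int]])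
  then have "(x + y) * of_int r ^ (k + l) \<in> \<int>" by (simp add: power_add algebra_simps)
  then show ?thesis by (auto simp: loc_def)
qed

lemma loc_diff: "x \<in> loc r \<Longrightarrow> y \<in> loc r \<Longrightarrow> x - y \<in> loc r"
  using loc_add[of x r "- y"] loc_uminus[of y r] by simp

lemma loc_inverse: "d dvd r \<Longrightarrow> d \<noteq> 0 \<Longrightarrow> 1 / of_int d \<in> loc r"
proof -
  assume "d dvd r" "d \<noteq> 0"
  then obtain c where "r = d * c" by auto
  then have "1 / of_int d * of_int r ^ 1 = (of_int c :: rat)" using \<open>d \<noteq> 0\<close> by simp
  then show ?thesis unfolding loc_def by (metis (mono_tags, lifting) Ints_of_int mem_Collect_eq)
qed

lemma loc_power_int:
  assumes "x \<in> loc r" "1 / x \<in> loc r" shows "x powi i \<in> loc r"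
proof -
  have "y ^ m \<in> loc r" if "y \<in> loc r" for y m
    by (induction m) (auto intro: loc_mult that)
  from this[OF assms(1)] this[OF assms(2)] show ?thesis
    by (auto simp: power_int_def field_simps)
qed

lemma loc_mono: "r dvd s \<Longrightarrow> loc r \<subseteq> loc s"
proof
  fix x assume "r dvd s" "x \<in> loc r"
  obtain c where c: "s = r * c" using \<open>r dvd s\<close> by (rule dvdE)
  obtain k where "x * of_int r ^ k \<in> \<int>" using \<open>x \<in> loc r\<close> by (auto simp: loc_def)
  then have "(x * of_int r ^ k) * of_int (c ^ k) \<in> \<int>" by (rule Ints_mult) (rule Ints_of_int)
  then have "x * of_int s ^ k \<in> \<int>" by (simp add: c power_mult_distrib mult_ac)
  then show "x \<in> loc s" by (auto simp: loc_def)
qed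

lemma loc_Int_coprime:
  assumes "coprime r s" "r \<noteq> 0" "x \<in> loc r" "x \<in> loc s"
  shows "x \<in> \<int>"
proof -
  obtain k l m m' where m: "x * of_int r ^ k = of_int m" "x * of_int s ^ l = of_int m'"
    using assms(3,4) by (auto simp: loc_def elim!: Ints_cases)
  have "of_int (m * s ^ l) = (of_int (m' * r ^ k) :: rat)"
    using m by (simp flip: m)
  then have "m * s ^ l = m' * r ^ k" by (simp only: of_int_eq_iff)
  then have "r ^ k dvd m * s ^ l" by simp
  moreover have "coprime (r ^ k) (s ^ l)" using assms(1) by simp
  ultimately have "r ^ k dvd m" using coprime_dvd_mult_left_iff by blast
  then obtain c where "m = r ^ k * c" by auto
  then have "x * of_int r ^ k = of_int c * of_int r ^ k" using m(1) by simp
  then have "x = of_int c" using assms(2) by simp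
  then show ?thesis by simp
qed

text \<open>A Bezout identity for \<open>r ^ k\<close> and \<open>s ^ k\<close> splits a fraction
  with denominator \<open>(r * s) ^ k\<close>.\<close>

lemma loc_partial_fractions:
  assumes "coprime r s" "r \<noteq> 0" "s \<noteq> 0" "x \<in> loc (r * s)"
  shows "\<exists>y\<in>loc r. \<exists>z\<in>loc s. x = y + z"
proof -
  obtain k m where m: "x * of_int (r * s) ^ k = of_int m"
    using assms(4) by (auto simp: loc_def elim!: Ints_cases)
  have "coprime (r ^ k) (s ^ k)" using assms(1) by simp
  then obtain a b where "a * r ^ k + b * s ^ k = 1" by (metis bezout_int coprime_imp_gcd_eq_1)
  then have "of_int (a * r ^ k + b * s ^ k) = (1 :: rat)" by simp
  then have ab: "of_int a * of_int r ^ k + of_int b * of_int s ^ k = (1 :: rat)" by simp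
  let ?y = "of_int (m * b) / of_int r ^ k :: rat" and ?z = "of_int (m * a) / of_int s ^ k :: rat"
  have "?y + ?z = of_int m * (of_int a * of_int r ^ k + of_int b * of_int s ^ k) / (of_int (r * s) ^ k)"
    using assms(2,3) by (simp add: field_simps)
  also have "\<dots> = x" using m assms(2,3) unfolding ab by (simp add: field_simps)
  finally have "x = ?y + ?z" by simp
  moreover have "?y \<in> loc r" "?z \<in> loc s" using assms(2,3) by (auto simp: loc_def intro!: exI[of _ k])
  ultimately show ?thesis by blast
qed

section \<open>The three places and their expanding directions\<close>

datatype place = Arch | AtP | AtQ

locale bs_parameter =
  fixes n :: int
  assumes n_nonzero: "n \<noteq> 0"
begin

text \<open>\<open>p\<close> and \<open>q\<close> are consecutive, hence coprime. Since
  \<open>n\<close> divides \<open>p\<close>, inverting \<open>p\<close> inverts \<open>n\<close> as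
  well; the factor 2 keeps \<open>p\<close> at least 2 when \<open>n\<close> is 1 or -1.\<close>

definition p :: int where "p = 2 * \<bar>n\<bar>"
definition q :: int where "q = 2 * \<bar>n\<bar> + 1"
definition P :: rat where "P = of_int p"
definition Q :: rat where "Q = of_int q"
definition N :: rat where "N = of_int n"

lemma pq: "p \<ge> 2" "q = p + 1" "n dvd p" "coprime p q"
  using n_nonzero by (auto simp: p_def q_def)

lemma PQ: "P \<ge> 2" "Q = P + 1" "P \<noteq> 0" "Q \<noteq> 0" "N \<noteq> 0" "\<bar>N\<bar> \<le> P" "\<bar>N\<bar> \<ge> 1"
proof -
  have "(of_int p :: rat) \<ge> of_int 2" using pq(1) by (simp only: of_int_le_iff)
  then show "P \<ge> 2" by (simp add: P_def)
  then show "P \<noteq> 0" "Q = P + 1" "Q \<noteq> 0" by (auto simp: P_def Q_def pq(2))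
  show "N \<noteq> 0" using n_nonzero by (simp add: N_def)
  have "\<bar>n\<bar> \<le> p" "\<bar>n\<bar> \<ge> 1" using n_nonzero by (auto simp: p_def)
  then have "(of_int \<bar>n\<bar> :: rat) \<le> of_int p" "of_int \<bar>n\<bar> \<ge> (of_int 1 :: rat)"
    by (simp_all only: of_int_le_iff)
  then show "\<bar>N\<bar> \<le> P" "\<bar>N\<bar> \<ge> 1" by (auto simp: N_def P_def)
qed

definition phi :: "int \<times> int \<times> int \<Rightarrow> rat" where
  "phi v = P powi fst v * Q powi fst (snd v) * N powi snd (snd v)"

abbreviation A :: "rat set" where "A \<equiv> loc (p * q)"

text \<open>An element of Z[1/(pq)] is integral at the primes dividing \<open>p\<close> exactly when
  it lies in Z[1/q]; hence \<open>p\<close> and \<open>q\<close> appear crossed over.\<close>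

fun U :: "place \<Rightarrow> rat set" where
  "U Arch = {x \<in> A. \<bar>x\<bar> \<le> 1}"
| "U AtP = loc q"
| "U AtQ = loc p"

sublocale digit_system U phi
proof
  show "phi 0 = 1" by (simp add: phi_def)
  show "phi (v + w) = phi v * phi w" for v w
    using PQ by (simp add: phi_def power_int_add)
  show "0 \<in> U i" for i by (cases i) auto
qed

lemma pq_loc: "P \<in> loc r" "Q \<in> loc r" "N \<in> loc r"
    "1 / P \<in> loc p" "1 / Q \<in> loc q" "1 / N \<in> loc p"
proof -
  have "q \<noteq> 0" "p \<noteq> 0" using pq by auto
  then show "1 / P \<in> loc p" "1 / Q \<in> loc q" "1 / N \<in> loc p"
    using pq(3) n_nonzero unfolding P_def Q_def N_def by (auto intro!: loc_inverse)
qed (simp_all only: P_def Q_def N_def of_int_loc)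

lemma loc_sub: "loc p \<subseteq> A" "loc q \<subseteq> A"
  by (rule loc_mono, simp)+

lemma phi_A: "phi v \<in> A"
  unfolding phi_def using pq_loc loc_sub by (intro loc_mult loc_power_int) auto

lemma A_phi_mult: "x \<in> A \<Longrightarrow> phi v * x \<in> A"
  using phi_A by (rule loc_mult)

lemma A_phi_div: "x \<in> A \<Longrightarrow> x / phi v \<in> A"
  using A_phi_mult[of x "- v"] by (simp add: phi_uminus)

lemma U_sub_A: "U i \<subseteq> A"
  using loc_sub by (cases i) auto

lemma phi_unit_steps:
  assumes "e \<in> unit_steps"
  shows "phi e \<in> {P, 1 / P, Q, 1 / Q, N, 1 / N}"
  using assms by (auto simp: unit_steps_def phi_def power_int_minus field_simps)

lemma phi_unit_steps_abs: "e \<in> unit_steps \<Longrightarrow> \<bar>phi e\<bar> \<le> Q"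
proof -
  have "\<bar>1 / P\<bar> \<le> 1" "\<bar>1 / Q\<bar> \<le> 1" "\<bar>1 / N\<bar> \<le> 1"
    using PQ by (auto simp: abs_divide divide_le_eq_1)
  moreover have "1 \<le> Q" "\<bar>P\<bar> \<le> Q" "\<bar>Q\<bar> \<le> Q" "\<bar>N\<bar> \<le> Q" using PQ by auto
  ultimately have "\<bar>x\<bar> \<le> Q" if "x \<in> {P, 1 / P, Q, 1 / Q, N, 1 / N}" for x
    using that by (blast intro: order_trans)
  then show "e \<in> unit_steps \<Longrightarrow> \<bar>phi e\<bar> \<le> Q" using phi_unit_steps by blast
qed

text \<open>Among the six values only \<open>1 / P\<close> and \<open>1 / N\<close> may fail to lie
  in \<open>loc q\<close>, and \<open>P\<close> clears both because \<open>n\<close> divides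
  \<open>p\<close>.\<close>

lemma phi_unit_steps_P: "e \<in> unit_steps \<Longrightarrow> phi e * P \<in> loc q"
proof -
  obtain c where "p = n * c" using pq(3) by auto
  then have "1 / N * P = of_int c" using PQ(5) by (simp add: P_def N_def)
  then have "1 / N * P \<in> loc q" by simp
  moreover have "1 / P * P \<in> loc q" using PQ(3) by simp
  moreover have "P * P \<in> loc q" "Q * P \<in> loc q" "1 / Q * P \<in> loc q" "N * P \<in> loc q"
    by (intro loc_mult pq_loc)+
  ultimately have "x * P \<in> loc q" if "x \<in> {P, 1 / P, Q, 1 / Q, N, 1 / N}" for x
    using that by blast
  then show "e \<in> unit_steps \<Longrightarrow> phi e * P \<in> loc q" using phi_unit_steps by blast
qed

lemma phi_unit_steps_Q: "e \<in> unit_steps \<Longrightarrow> phi e * Q \<in> loc p"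
proof -
  have "1 / Q * Q \<in> loc p" using PQ(4) by simp
  moreover have "P * Q \<in> loc p" "1 / P * Q \<in> loc p" "Q * Q \<in> loc p" "N * Q \<in> loc p" "1 / N * Q \<in> loc p"
    by (intro loc_mult pq_loc)+
  ultimately have "x * Q \<in> loc p" if "x \<in> {P, 1 / P, Q, 1 / Q, N, 1 / N}" for x
    using that by blast
  then show "e \<in> unit_steps \<Longrightarrow> phi e * Q \<in> loc p" using phi_unit_steps by blast
qed

text \<open>\<open>Q\<close> is at least 2 and at least the absolute value of every
  \<open>phi e\<close>, so dividing by a number of absolute value at least \<open>Q\<close> brings
  sums and images of ball elements back into the ball.\<close>

lemma expands_Arch:
  assumes "set V \<subseteq> unit_steps" "length V \<le> 5" "Q \<le> \<bar>phi (sum_list V)\<bar>"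
  shows "expands V Arch"
proof -
  let ?f = "phi (sum_list V)"
  have f: "\<bar>?f\<bar> > 0" by simp
  have 1: "(x + y) / ?f \<in> U Arch" if "x \<in> U Arch" "y \<in> U Arch" for x y
  proof -
    have "\<bar>x + y\<bar> \<le> \<bar>?f\<bar>" using that assms(3) PQ by auto
    then have "\<bar>(x + y) / ?f\<bar> \<le> 1" using f by (simp add: abs_divide divide_le_eq_1)
    then show ?thesis using that by (auto intro!: A_phi_div loc_add)
  qed
  have 2: "phi e * x / ?f \<in> U Arch" if "e \<in> unit_steps" "x \<in> U Arch" for x e
  proof -
    have "\<bar>phi e * x\<bar> \<le> Q * 1"
      unfolding abs_mult using that phi_unit_steps_abs[OF that(1)] by (intro mult_mono) auto
    then have "\<bar>phi e * x\<bar> \<le> \<bar>?f\<bar>" using assms(3) by simp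
    then have "\<bar>phi e * x / ?f\<bar> \<le> 1" using f by (simp only: abs_divide divide_le_eq_1) simp
    then show ?thesis using that by (auto intro!: A_phi_div A_phi_mult simp del: times_divide_eq_left)
  qed
  show ?thesis unfolding expands_def using assms 1 2 by blast
qed

text \<open>Here the ball is a ring, so sums are harmless; the factor \<open>P\<close> contained in
  \<open>1 / phi (sum_list V)\<close> clears the denominators introduced by a unit step.\<close>

lemma expands_AtP:
  assumes "set V \<subseteq> unit_steps" "length V \<le> 5" "1 / phi (sum_list V) = P * c" "c \<in> loc q"
  shows "expands V AtP"
proof -
  have d: "x / phi (sum_list V) = x * P * c" for x using assms(3) by (metis mult.assoc mult.right_neutral times_divide_eq_right)
  have 1: "(x + y) / phi (sum_list V) \<in> U AtP" if "x \<in> U AtP" "y \<in> U AtP" for x y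
    unfolding d using that assms(4) pq_loc by (auto intro!: loc_mult loc_add)
  have 2: "phi e * x / phi (sum_list V) \<in> U AtP" if "e \<in> unit_steps" "x \<in> U AtP" for x e
  proof -
    have eq: "phi e * x / phi (sum_list V) = (phi e * P) * x * c" unfolding d by simp
    show ?thesis unfolding eq using that(2) assms(4) phi_unit_steps_P[OF that(1)]
      by (simp only: U.simps loc_mult)
  qed
  show ?thesis unfolding expands_def using assms 1 2 by blast
qed

lemma expands_AtQ:
  assumes "set V \<subseteq> unit_steps" "length V \<le> 5" "1 / phi (sum_list V) = Q * c" "c \<in> loc p"
  shows "expands V AtQ"
proof -
  have d: "x / phi (sum_list V) = x * Q * c" for x using assms(3) by (metis mult.assoc mult.right_neutral times_divide_eq_right)
  have 1: "(x + y) / phi (sum_list V) \<in> U AtQ" if "x \<in> U AtQ" "y \<in> U AtQ" for x y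
    unfolding d using that assms(4) pq_loc by (auto intro!: loc_mult loc_add)
  have 2: "phi e * x / phi (sum_list V) \<in> U AtQ" if "e \<in> unit_steps" "x \<in> U AtQ" for x e
  proof -
    have eq: "phi e * x / phi (sum_list V) = (phi e * Q) * x * c" unfolding d by simp
    show ?thesis unfolding eq using that(2) assms(4) phi_unit_steps_Q[OF that(1)]
      by (simp only: U.simps loc_mult)
  qed
  show ?thesis unfolding expands_def using assms 1 2 by blast
qed

text \<open>No two of the three weights \<open>(log P, log Q)\<close>, \<open>(- log P, 0)\<close>, \<open>(0, - log Q)\<close> are opposite,
  so that for every pair of places there is a common expanding direction, namely \<open>Q\<^sup>2/P\<close>,
  \<open>P\<^sup>4/Q\<close> and \<open>1/(PQ)\<close>.\<close>

fun zeta :: "place \<Rightarrow> place \<Rightarrow> (int \<times> int \<times> int) list" where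
  "zeta Arch AtQ = [(1, 0, 0), (1, 0, 0), (1, 0, 0), (1, 0, 0), (0, -1, 0)]"
| "zeta AtQ Arch = [(1, 0, 0), (1, 0, 0), (1, 0, 0), (1, 0, 0), (0, -1, 0)]"
| "zeta Arch _ = [(-1, 0, 0), (0, 1, 0), (0, 1, 0)]"
| "zeta _ Arch = [(-1, 0, 0), (0, 1, 0), (0, 1, 0)]"
| "zeta _ _ = [(-1, 0, 0), (0, -1, 0)]"

lemma phi_zeta:
  "phi (sum_list [(-1, 0, 0), (0, 1, 0), (0, 1, 0)]) = Q\<^sup>2 / P"
  "phi (sum_list [(1, 0, 0), (1, 0, 0), (1, 0, 0), (1, 0, 0), (0, -1, 0)]) = P ^ 4 / Q"
  "phi (sum_list [(-1, 0, 0), (0, -1, 0)]) = 1 / (P * Q)"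
  by (simp_all add: phi_def power_int_minus field_simps)

lemma expands_zeta:
  "expands [(-1, 0, 0), (0, 1, 0), (0, 1, 0)] Arch"
  "expands [(-1, 0, 0), (0, 1, 0), (0, 1, 0)] AtP"
  "expands [(1, 0, 0), (1, 0, 0), (1, 0, 0), (1, 0, 0), (0, -1, 0)] Arch"
  "expands [(1, 0, 0), (1, 0, 0), (1, 0, 0), (1, 0, 0), (0, -1, 0)] AtQ"
  "expands [(-1, 0, 0), (0, -1, 0)] AtP"
  "expands [(-1, 0, 0), (0, -1, 0)] AtQ"
proof -
  have steps: "set [(-1, 0, 0), (0, 1, 0), (0, 1, 0)] \<subseteq> unit_steps"
    "set [(1, 0, 0), (1, 0, 0), (1, 0, 0), (1, 0, 0), (0, -1, 0)] \<subseteq> unit_steps"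
    "set [(-1, 0, 0), (0, -1, 0)] \<subseteq> unit_steps"
    by (auto simp: unit_steps_def)
  have "Q * P \<le> Q * Q" using PQ by (intro mult_left_mono) auto
  then have "Q \<le> \<bar>Q\<^sup>2 / P\<bar>" using PQ by (simp add: abs_divide field_simps power2_eq_square)
  then show "expands [(-1, 0, 0), (0, 1, 0), (0, 1, 0)] Arch"
    by (intro expands_Arch steps) (simp_all only: phi_zeta, simp)
  \<comment> \<open>The exponent 4 in \<open>P ^ 4 / Q\<close> comes from here: this number is at
    least \<open>Q\<close> because \<open>P * P\<close> is at least \<open>2 * P\<close>, which is
    at least \<open>P + 1\<close>.\<close>
  have "Q \<le> P * P"
  proof -
    have "2 * P \<le> P * P" using PQ by (intro mult_right_mono) auto
    then show ?thesis using PQ(1,2) by linarith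
  qed
  then have "Q * Q \<le> (P * P) * (P * P)" using PQ by (intro mult_mono) auto
  then have "Q \<le> \<bar>P ^ 4 / Q\<bar>" using PQ by (simp add: abs_divide field_simps power4_eq_xxxx)
  then show "expands [(1, 0, 0), (1, 0, 0), (1, 0, 0), (1, 0, 0), (0, -1, 0)] Arch"
    by (intro expands_Arch steps) (simp_all only: phi_zeta, simp)
  \<comment> \<open>The reciprocal of \<open>Q^2 / P\<close> is \<open>P\<close> times
    \<open>1 / Q^2\<close>; the other witnesses \<open>c\<close> are read off the reciprocals in the
    same way.\<close>
  have "1 / Q * (1 / Q) \<in> loc q" using pq_loc by (intro loc_mult)
  then show "expands [(-1, 0, 0), (0, 1, 0), (0, 1, 0)] AtP"
    by (intro expands_AtP[where c = "1 / Q * (1 / Q)"] steps)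
       (simp_all only: phi_zeta, simp_all add: power2_eq_square)
  have "1 / P * (1 / P) * (1 / P * (1 / P)) \<in> loc p" using pq_loc by (intro loc_mult)
  then show "expands [(1, 0, 0), (1, 0, 0), (1, 0, 0), (1, 0, 0), (0, -1, 0)] AtQ"
    by (intro expands_AtQ[where c = "1 / P * (1 / P) * (1 / P * (1 / P))"] steps)
       (simp_all only: phi_zeta, simp_all add: power4_eq_xxxx)
  show "expands [(-1, 0, 0), (0, -1, 0)] AtP"
    by (intro expands_AtP[where c = Q] steps) (simp_all only: phi_zeta pq_loc, simp_all)
  show "expands [(-1, 0, 0), (0, -1, 0)] AtQ"
    by (intro expands_AtQ[where c = P] steps) (simp_all only: phi_zeta pq_loc, simp_all)
qed

sublocale tame_system U phi zeta "[Arch, AtP, AtQ]"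
proof
  show "expands (zeta i j) i" "expands (zeta i j) j" for i j
    by (cases i; cases j; simp only: zeta.simps expands_zeta)+
  show "set [Arch, AtP, AtQ] = UNIV" using place.exhaust by auto
qed auto

section \<open>The semidirect product of Z[1/(pq)] with Z^3\<close>

definition el :: "rat \<Rightarrow> int \<times> int \<times> int \<Rightarrow> nat" where
  "el a v = to_nat (a, v)"

text \<open>Elements are coded as natural numbers because the final statement asks for a
  \<open>nat monoid\<close>; \<open>fib\<close> and \<open>bas\<close> decode the component in the
  normal subgroup and the one in Z^3.\<close>

definition fib :: "nat \<Rightarrow> rat" where "fib x = fst (from_nat x :: rat \<times> int \<times> int \<times> int)"
definition bas :: "nat \<Rightarrow> int \<times> int \<times> int" where "bas x = snd (from_nat x :: rat \<times> int \<times> int \<times> int)"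

lemma fib_el [simp]: "fib (el a v) = a" and bas_el [simp]: "bas (el a v) = v"
  by (simp_all add: fib_def bas_def el_def)

lemma el_eq_iff [simp]: "el a v = el b w \<longleftrightarrow> a = b \<and> v = w"
  by (auto simp: el_def)

definition Gam :: "nat monoid" where
  "Gam = \<lparr>carrier = {el a v | a v. a \<in> A},
     mult = (\<lambda>x y. el (fib x + phi (bas x) * fib y) (bas x + bas y)), one = el 0 0\<rparr>"

lemma el_mult [simp]: "el a v \<otimes>\<^bsub>Gam\<^esub> el b w = el (a + phi v * b) (v + w)"
  by (simp add: Gam_def)

lemma Gam_one: "\<one>\<^bsub>Gam\<^esub> = el 0 0"
  by (simp add: Gam_def)

lemma el_carrier [simp]: "el a v \<in> carrier Gam \<longleftrightarrow> a \<in> A"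
  by (cases v) (auto simp: Gam_def)

lemma Gam_cases: "x \<in> carrier Gam \<Longrightarrow> (\<And>a v. x = el a v \<Longrightarrow> a \<in> A \<Longrightarrow> thesis) \<Longrightarrow> thesis"
  by (auto simp: Gam_def)

sublocale Gam: group Gam
proof (rule groupI)
  fix x y assume "x \<in> carrier Gam" "y \<in> carrier Gam"
  then show "x \<otimes>\<^bsub>Gam\<^esub> y \<in> carrier Gam"
    by (elim Gam_cases) (auto intro: loc_add A_phi_mult)
  fix z assume "z \<in> carrier Gam"
  with \<open>x \<in> carrier Gam\<close> \<open>y \<in> carrier Gam\<close>
  show "x \<otimes>\<^bsub>Gam\<^esub> y \<otimes>\<^bsub>Gam\<^esub> z = x \<otimes>\<^bsub>Gam\<^esub> (y \<otimes>\<^bsub>Gam\<^esub> z)"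
    by (elim Gam_cases) (auto simp: phi_add algebra_simps)
next
  fix x assume "x \<in> carrier Gam"
  then show "\<one>\<^bsub>Gam\<^esub> \<otimes>\<^bsub>Gam\<^esub> x = x" by (elim Gam_cases) (auto simp: Gam_one)
  from \<open>x \<in> carrier Gam\<close> show "\<exists>y\<in>carrier Gam. y \<otimes>\<^bsub>Gam\<^esub> x = \<one>\<^bsub>Gam\<^esub>"
  proof (elim Gam_cases)
    fix a v assume x: "x = el a v" "a \<in> A"
    then have "el (- (phi (- v) * a)) (- v) \<in> carrier Gam" by (auto intro: loc_uminus A_phi_mult)
    moreover have "el (- (phi (- v) * a)) (- v) \<otimes>\<^bsub>Gam\<^esub> x = \<one>\<^bsub>Gam\<^esub>" by (simp add: x Gam_one)
    ultimately show ?thesis by blast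
  qed
qed (simp add: Gam_one)

lemma el_inv [simp]: "a \<in> A \<Longrightarrow> inv\<^bsub>Gam\<^esub> (el a v) = el (- (phi (- v) * a)) (- v)"
  by (rule Gam.inv_equality) (auto simp: Gam_one intro: loc_uminus A_phi_mult)

section \<open>Retracting the model onto the group\<close>

text \<open>Strong approximation: the denominators at \<open>p\<close> and at \<open>q\<close> can
  be prescribed independently, and an integer shift then adjusts the real size without disturbing
  integrality.\<close>

lemma approximation:
  assumes "\<And>i. b i \<in> A"
  shows "\<exists>x\<in>A. \<forall>i. x - b i \<in> U i"
proof -
  have nz: "p \<noteq> 0" "q \<noteq> 0" using pq by auto
  obtain y z where yz: "y \<in> loc p" "z \<in> loc q" "b AtP = y + z"
    using loc_partial_fractions[OF pq(4) nz assms] by blast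
  obtain y' z' where yz': "y' \<in> loc p" "z' \<in> loc q" "b AtQ = y' + z'"
    using loc_partial_fractions[OF pq(4) nz assms] by blast
  \<comment> \<open>\<open>y\<close> carries the denominators of \<open>b AtP\<close> at
    \<open>p\<close>, and \<open>z'\<close> those of \<open>b AtQ\<close> at \<open>q\<close>;
    \<open>m\<close> brings their sum within distance 1 of \<open>b Arch\<close>.\<close>
  define m where "m = \<lfloor>b Arch - y - z'\<rfloor>"
  define x where "x = y + z' + of_int m"
  have xA: "x \<in> A" unfolding x_def
    by (intro loc_add of_int_loc loc_sub[THEN subsetD] yz yz')
  have "x - b i \<in> U i" for i
  proof (cases i)
    case Arch
    have "\<bar>x - b Arch\<bar> \<le> 1" unfolding x_def m_def by linarith
    then show ?thesis unfolding Arch U.simps using loc_diff[OF xA assms] by simp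
  next
    case AtP
    have "x - b AtP = z' - z + of_int m" by (simp add: x_def yz)
    then show ?thesis unfolding AtP U.simps by (simp only: loc_add loc_diff of_int_loc yz yz')
  next
    case AtQ
    have "x - b AtQ = y - y' + of_int m" by (simp add: x_def yz')
    then show ?thesis unfolding AtQ U.simps by (simp only: loc_add loc_diff of_int_loc yz yz')
  qed
  with xA show ?thesis by blast
qed

section \<open>The retraction and its displacements\<close>

type_synonym state = "(place \<Rightarrow> rat) \<times> int \<times> int \<times> int"

definition valid :: "state \<Rightarrow> bool" where
  "valid s \<longleftrightarrow> (\<forall>i. fst s i \<in> A)"

text \<open>The last clause makes the retraction restrict to the identity on the diagonal copy of the group.\<close>

definition near :: "state \<Rightarrow> rat \<Rightarrow> bool" where
  "near s x \<longleftrightarrow> x \<in> A \<and> (\<forall>i. (x - fst s i) / phi (snd s) \<in> U i) \<and>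
     (\<forall>a. fst s = (\<lambda>_. a) \<longrightarrow> x = a)"

definition ret :: "state \<Rightarrow> rat" where
  "ret s = (SOME x. near s x)"

lemma near_ret:
  assumes "valid s"
  shows "near s (ret s)"
  unfolding ret_def
proof (rule someI_ex)
  show "\<exists>x. near s x"
  proof (cases "\<exists>a. fst s = (\<lambda>_. a)")
    case True
    then obtain a where a: "fst s = (\<lambda>_. a)" by blast
    then have "near s a" using assms by (auto simp: near_def valid_def zero_digit dest: fun_cong)
    then show ?thesis by blast
  next
    case False
    \<comment> \<open>\<open>near\<close> measures distances after division by
      \<open>phi (snd s)\<close>, so the rescaled coordinates are approximated and the result is
      scaled back.\<close>
    obtain x where x: "x \<in> A" "\<And>i. x - fst s i / phi (snd s) \<in> U i"
      using approximation[of "\<lambda>i. fst s i / phi (snd s)"] assms A_phi_div by (auto simp: valid_def)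
    have "(phi (snd s) * x - fst s i) / phi (snd s) = x - fst s i / phi (snd s)" for i
      by (simp add: field_simps)
    then have "near s (phi (snd s) * x)" using x False A_phi_mult by (auto simp: near_def)
    then show ?thesis by blast
  qed
qed

lemma ret_const [simp]: "a \<in> A \<Longrightarrow> ret (\<lambda>_. a, v) = a"
  using near_ret[of "(\<lambda>_. a, v)"] by (simp add: near_def valid_def)

text \<open>A state is regarded as an element of the big semidirect product, and this is right
  multiplication by the value of \<open>w\<close>.\<close>

definition moves :: "state \<Rightarrow> place gen list \<Rightarrow> state" where
  "moves s w = (\<lambda>i. fst s i + phi (snd s) * coord i w, snd s + sum_list (steps w))"

lemma moves_Nil [simp]: "moves s [] = s"
  by (simp add: moves_def)

lemma moves_append: "moves s (u @ w) = moves (moves s u) w"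
  by (simp add: moves_def phi_add algebra_simps)

lemma moves_Cons: "moves s (g # w) = moves (moves s [g]) w"
  using moves_append[of s "[g]" w] by simp

lemma coord_A: "ok w \<Longrightarrow> coord i w \<in> A"
proof (induction w)
  case (Cons g w)
  then show ?case using U_sub_A by (cases g) (auto intro: loc_add A_phi_mult)
qed simp

lemma valid_moves: "valid s \<Longrightarrow> ok w \<Longrightarrow> valid (moves s w)"
  using coord_A by (auto simp: valid_def moves_def intro!: loc_add A_phi_mult)

text \<open>This is \<open>g^-1 g'\<close> in \<open>Gam\<close>, where \<open>g\<close> and
  \<open>g'\<close> are the images \<open>el (ret s) (snd s)\<close> and
  \<open>el (ret s') (snd s')\<close> of the two states; hence edges telescope along a path
  (\<open>edge_trans\<close>).\<close>

definition edge :: "state \<Rightarrow> state \<Rightarrow> nat" where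
  "edge s s' = el ((ret s' - ret s) / phi (snd s)) (snd s' - snd s)"

lemma edge_self: "edge s s = el 0 0"
  by (simp add: edge_def)

lemma edge_trans: "edge s s' \<otimes>\<^bsub>Gam\<^esub> edge s' s'' = edge s s''"
proof -
  have "phi (snd s' - snd s) = phi (snd s') / phi (snd s)"
    using phi_add[of "snd s'" "- snd s"] by (simp add: phi_uminus)
  then show ?thesis by (simp add: edge_def field_simps)
qed

text \<open>Designed to contain every displacement of the retraction along one generator
  (\<open>edge_S0\<close>): \<open>d\<close> is bounded at all three places, and \<open>e\<close> is
  0 for a digit.\<close>

definition S0 :: "nat set" where
  "S0 = {el d e | d e. P * d \<in> loc q \<and> Q * d \<in> loc p \<and> \<bar>d\<bar> \<le> Q + 2 \<and> d \<in> A \<and> e \<in> insert 0 unit_steps}"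

text \<open>\<open>P * Q * d\<close> lies in \<open>loc p\<close> and in \<open>loc q\<close>, hence
  is an integer, and its absolute value is bounded.\<close>

lemma finite_S0: "finite S0"
proof -
  let ?D = "{d. P * d \<in> loc q \<and> Q * d \<in> loc p \<and> \<bar>d\<bar> \<le> Q + 2}"
  let ?B = "\<lceil>P * Q * (Q + 2)\<rceil>"
  have "?D \<subseteq> (\<lambda>m. of_int m / (P * Q)) ` {- ?B..?B}"
  proof
    fix d assume d: "d \<in> ?D"
    have "Q * (P * d) \<in> loc q" "P * (Q * d) \<in> loc p"
      using d pq_loc by (auto intro: loc_mult)
    then have "P * Q * d \<in> \<int>"
      using loc_Int_coprime[OF pq(4)] pq(1) by (simp add: mult_ac)
    then obtain m where m: "P * Q * d = of_int m" by (auto elim: Ints_cases)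
    have "\<bar>P * Q * d\<bar> \<le> P * Q * (Q + 2)"
      using d PQ by (auto simp: abs_mult intro!: mult_left_mono)
    then have "\<bar>of_int m\<bar> \<le> (of_int ?B :: rat)" unfolding m by linarith
    then have "m \<in> {- ?B..?B}" by (auto simp: abs_le_iff)
    moreover have "d = of_int m / (P * Q)" using PQ(3,4) by (simp add: field_simps flip: m)
    ultimately show "d \<in> (\<lambda>m. of_int m / (P * Q)) ` {- ?B..?B}" by blast
  qed
  then have "finite ?D" by (rule finite_subset) auto
  then have "finite ((\<lambda>(d, e). el d e) ` (?D \<times> insert 0 unit_steps))"
    by (intro finite_imageI finite_cartesian_product) (auto simp: unit_steps_def)
  then show ?thesis by (rule rev_finite_subset) (auto simp: S0_def)
qed

lemma edge_S0:
  assumes s: "valid s" and g: "gen_ok g"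
  shows "edge s (moves s [g]) \<in> S0"
proof -
  let ?s = "moves s [g]" and ?v = "snd s"
  define x where "x = (\<lambda>i. (ret s - fst s i) / phi ?v)"
  define x' where "x' = (\<lambda>i. (ret ?s - fst ?s i) / phi (snd ?s))"
  define d where "d = (ret ?s - ret s) / phi ?v"
  have "valid ?s" using s g by (intro valid_moves) auto
  then have xU: "x i \<in> U i" "x' i \<in> U i" and dA: "d \<in> A" for i
    using near_ret[OF s] near_ret[OF \<open>valid ?s\<close>] unfolding near_def x_def x'_def d_def
    by (auto intro: A_phi_div loc_diff)
  have bound: "P * d \<in> loc q \<and> Q * d \<in> loc p \<and> \<bar>d\<bar> \<le> Q + 2 \<and> snd ?s - ?v \<in> insert 0 unit_steps"
  proof (cases g)
    case (Step e)
    then have e: "e \<in> unit_steps" "snd ?s = ?v + e" "fst ?s = fst s" using g by (auto simp: moves_def)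
    \<comment> \<open>The displacement does not depend on the place \<open>i\<close>. It is
      expressed through the approximation errors before and after the step at whichever place is to
      be estimated.\<close>
    have d: "d = phi e * x' i - x i" for i
      by (simp add: d_def x_def x'_def e phi_add field_simps)
    have "P * d = (phi e * P) * x' AtP - P * x AtP"
      by (simp add: d[of AtP] algebra_simps)
    then have "P * d \<in> loc q" using xU[of AtP] phi_unit_steps_P[OF e(1)] pq_loc
      by (auto intro!: loc_diff loc_mult[of "phi e * P"] loc_mult[of P])
    moreover have "Q * d = (phi e * Q) * x' AtQ - Q * x AtQ"
      by (simp add: d[of AtQ] algebra_simps)
    then have "Q * d \<in> loc p" using xU[of AtQ] phi_unit_steps_Q[OF e(1)] pq_loc
      by (auto intro!: loc_diff loc_mult[of "phi e * Q"] loc_mult[of Q])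
    moreover have "\<bar>phi e * x' Arch\<bar> \<le> Q * 1"
      unfolding abs_mult using xU[of Arch] phi_unit_steps_abs[OF e(1)] by (intro mult_mono) auto
    then have "\<bar>d\<bar> \<le> Q + 2" using xU[of Arch] unfolding d[of Arch] by auto
    ultimately show ?thesis using e by simp
  next
    case (Digit j y)
    then have y: "y \<in> U j" and v: "snd ?s = ?v" using g by (auto simp: moves_def)
    have d: "d = x' i - x i + (if j = i then y else 0)" for i
      by (simp add: d_def x_def x'_def Digit moves_def field_simps)
    have yU: "(if j = i then y else 0) \<in> U i" for i using y zero_digit by auto
    have "d \<in> loc q"
      unfolding d[of AtP] using yU[of AtP] xU[of AtP] by (simp only: U.simps loc_add loc_diff)
    moreover have "d \<in> loc p"
      unfolding d[of AtQ] using yU[of AtQ] xU[of AtQ] by (simp only: U.simps loc_add loc_diff)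
    moreover have "\<bar>x' Arch\<bar> \<le> 1" "\<bar>x Arch\<bar> \<le> 1" "\<bar>if j = Arch then y else 0\<bar> \<le> 1"
      using yU[of Arch] xU[of Arch] by (simp_all only: U.simps mem_Collect_eq)
    then have "\<bar>d\<bar> \<le> 3" unfolding d[of Arch] by linarith
    ultimately show ?thesis using v PQ(1,2) pq_loc by (auto intro: loc_mult)
  qed
  then show ?thesis using dA unfolding S0_def edge_def d_def by blast
qed

definition S :: "nat set" where
  "S = S0 \<union> (\<lambda>x. inv\<^bsub>Gam\<^esub> x) ` S0"

lemma S0_carrier: "S0 \<subseteq> carrier Gam"
  by (auto simp: S0_def)

lemma S_carrier: "S \<subseteq> carrier Gam" and finite_S: "finite S"
  using S0_carrier finite_S0 by (auto simp: S_def)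

lemma S_inv: "x \<in> S \<Longrightarrow> inv\<^bsub>Gam\<^esub> x \<in> S"
  using S0_carrier by (auto simp: S_def)

section \<open>Transport of words along the retraction\<close>

fun push :: "state \<Rightarrow> place gen list \<Rightarrow> nat word" where
  "push s [] = []"
| "push s (g # w) = (edge s (moves s [g]), True) # push (moves s [g]) w"

lemma push_append: "push s (u @ w) = push s u @ push (moves s u) w"
proof (induction u arbitrary: s)
  case (Cons g u)
  have "moves (moves s [g]) u = moves s (g # u)" by (rule moves_Cons[symmetric])
  with Cons show ?case by simp
qed simp

lemma length_push [simp]: "length (push s w) = length w"
  by (induction s w rule: push.induct) auto

lemma push_words: "valid s \<Longrightarrow> ok w \<Longrightarrow> push s w \<in> words S"
proof (induction w arbitrary: s)
  case (Cons g w)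
  then have "valid (moves s [g])" by (intro valid_moves) auto
  with Cons edge_S0 show ?case by (auto simp: S_def)
qed simp

lemma word_val_push: "word_val Gam (push s w) = edge s (moves s w)"
proof (induction w arbitrary: s)
  case Nil
  then show ?case by (simp add: edge_self Gam_one)
next
  case (Cons g w)
  have "moves (moves s [g]) w = moves s (g # w)" by (rule moves_Cons[symmetric])
  with Cons show ?case by (simp add: Gam.word_val_Cons edge_trans)
qed

text \<open>Both sides of a relation lead from any state to the same state. Their transports thus
  have equal value and at most 40 letters, and the transport of the rest of the word is
  unaffected.\<close>

lemma push_chain:
  assumes "40 \<le> l" "valid s"
  shows "homot m w w' \<Longrightarrow> ok w \<Longrightarrow> chain (short_eq Gam S l) m (push s w) (push s w')"
proof (induction rule: chain.induct)
  case (chain_refl m w)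
  show ?case by (rule chain.chain_refl)
next
  case (chain_step a b m u v w)
  from chain_step.hyps(1) have ab: "ok a" "ok b" "length a \<le> 40" "length b \<le> 40"
      "\<And>s. moves s a = moves s b" by (auto simp: rel_def moves_def)
  have u: "valid (moves s u)" using assms(2) chain_step.prems by (intro valid_moves) auto
  have "short_eq Gam S l (push (moves s u) a) (push (moves s u) b)"
    using ab assms(1) u push_words by (simp add: short_eq_def word_val_push)
  moreover have "chain (short_eq Gam S l) m (push s u @ push (moves s u) b @ push (moves (moves s u) a) v) (push s w)"
    using chain_step.IH chain_step.prems ab by (simp add: push_append)
  ultimately show ?case by (simp add: push_append chain.chain_step)
qed

text \<open>At the archimedean place the standard direction multiplies by \<open>Q^2 / P\<close>,
  which is at least 2; at the other two, powers of \<open>P * Q\<close> clear all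
  denominators.\<close>

lemma level_exhausts:
  assumes "a \<in> A" shows "\<exists>m. lev i m a"
proof (cases i)
  case Arch
  obtain k where k: "\<bar>a\<bar> \<le> of_nat k" using real_arch_simple[of "\<bar>a\<bar>"] by blast
  have "P * P \<le> Q * Q" using PQ by (intro mult_mono) auto
  then have "2 * P \<le> Q * Q" using PQ(1) mult_right_mono[OF PQ(1), of P] by linarith
  then have 2: "2 \<le> Q\<^sup>2 / P" using PQ by (simp add: field_simps power2_eq_square)
  have "\<bar>a\<bar> \<le> (Q\<^sup>2 / P) ^ k"
  proof -
    have "(of_nat k :: rat) \<le> 2 ^ k" using of_nat_less_two_power[of k] by (simp add: less_imp_le)
    also have "\<dots> \<le> (Q\<^sup>2 / P) ^ k" using 2 by (intro power_mono) auto
    finally show ?thesis using k by simp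
  qed
  then have "\<bar>a / (Q\<^sup>2 / P) ^ k\<bar> \<le> 1" using 2 by (simp add: abs_divide divide_le_eq_1)
  moreover have "a / (Q\<^sup>2 / P) ^ k \<in> A"
    using assms A_phi_div[of a "sum_list (rep k (zeta Arch Arch))"] unfolding phi_sum_rep
    by (simp only: zeta.simps phi_zeta)
  ultimately have "lev Arch k a" by (simp only: level_def zeta.simps phi_zeta U.simps mem_Collect_eq)
  then show ?thesis using Arch by blast
next
  case AtP
  obtain k where "a * of_int (p * q) ^ k \<in> \<int>" using assms by (auto simp: loc_def)
  then have "a / (1 / (P * Q)) ^ k \<in> loc q" by (intro Ints_loc) (simp add: P_def Q_def field_simps)
  then have "lev AtP k a" by (simp only: level_def zeta.simps phi_zeta U.simps)
  then show ?thesis using AtP by blast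
next
  case AtQ
  obtain k where "a * of_int (p * q) ^ k \<in> \<int>" using assms by (auto simp: loc_def)
  then have "a / (1 / (P * Q)) ^ k \<in> loc p" by (intro Ints_loc) (simp add: P_def Q_def field_simps)
  then have "lev AtQ k a" by (simp only: level_def zeta.simps phi_zeta U.simps)
  then show ?thesis using AtQ by blast
qed

lemma steps_exhaust: "\<exists>V. set V \<subseteq> unit_steps \<and> sum_list V = v"
proof -
  have *: "\<exists>V. set V \<subseteq> unit_steps \<and> sum_list V = (i * fst e, i * fst (snd e), i * snd (snd e))"
    if e: "e \<in> unit_steps" for e and i :: int
  proof -
    have nat: "\<exists>V. set V \<subseteq> unit_steps \<and> sum_list V = (int m * fst f, int m * fst (snd f), int m * snd (snd f))"
      if f: "f \<in> unit_steps" for f m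
    proof (induction m)
      case 0
      show ?case by (intro exI[of _ "[]"]) (simp add: zero_prod_def)
    next
      case (Suc m)
      then obtain V where "set V \<subseteq> unit_steps" "sum_list V = (int m * fst f, int m * fst (snd f), int m * snd (snd f))"
        by blast
      then show ?case using f by (intro exI[of _ "f # V"]) (cases f, auto simp: algebra_simps)
    qed
    show ?thesis
      using nat[OF e, of "nat i"] nat[OF uminus_unit_steps[OF e], of "nat (- i)"]
      by (cases "i \<ge> 0") auto
  qed
  obtain i j k where v: "v = (i, j, k)" by (cases v) auto
  have "(1, 0, 0) \<in> unit_steps" "(0, 1, 0) \<in> unit_steps" "(0, 0, 1) \<in> unit_steps"
    by (auto simp: unit_steps_def)
  from *[OF this(1), of i] *[OF this(2), of j] *[OF this(3), of k] obtain V1 V2 V3 where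
    "set V1 \<subseteq> unit_steps" "sum_list V1 = (i, 0, 0)" "set V2 \<subseteq> unit_steps" "sum_list V2 = (0, j, 0)"
    "set V3 \<subseteq> unit_steps" "sum_list V3 = (0, 0, k)"
    by auto
  then show ?thesis by (intro exI[of _ "V1 @ V2 @ V3"]) (auto simp: v)
qed

section \<open>From words over the finite generating set to words of the model and back\<close>

definition represents :: "place gen list \<Rightarrow> nat \<Rightarrow> bool" where
  "represents w x \<longleftrightarrow> ok w \<and> (\<forall>i. coord i w = fib x) \<and> sum_list (steps w) = bas x"

lemma represents_ex:
  assumes "x \<in> carrier Gam" shows "\<exists>w. represents w x"
proof -
  obtain a v where x: "x = el a v" "a \<in> A" using assms by (rule Gam_cases)
  obtain f where f: "\<And>i. lev i (f i) a" using level_exhausts[OF x(2)] by metis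
  define m where "m = f Arch + f AtP + f AtQ"
  have fm: "f i \<le> m" for i by (cases i) (auto simp: m_def)
  have l: "lev i m a" for i by (rule level_mono[OF zeta(1) f fm])
  obtain V where V: "set V \<subseteq> unit_steps" "sum_list V = v" using steps_exhaust by blast
  from lev_word[of m "\<lambda>_. a", OF l V(1)] show ?thesis unfolding represents_def x(1) fib_el bas_el V(2) by blast
qed

lemma represents_append:
  assumes "represents u x" "represents w y" "x \<in> carrier Gam" "y \<in> carrier Gam"
  shows "represents (u @ w) (x \<otimes>\<^bsub>Gam\<^esub> y)"
  using assms(3,4,1,2) by (elim Gam_cases) (auto simp: represents_def)

lemma moves_represents:
  "represents w (el b u) \<Longrightarrow> moves (\<lambda>_. a, v) w = (\<lambda>_. a + phi v * b, v + u)"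
  by (simp add: represents_def moves_def)

text \<open>A word representing an element of \<open>Gam\<close> leads from diagonal states to
  diagonal states. There \<open>ret\<close> is the identity, so the edge between the end points
  recovers the element.\<close>

lemma word_val_push_represents:
  assumes "represents w x" "x \<in> carrier Gam" "a \<in> A"
  shows "word_val Gam (push (\<lambda>_. a, v) w) = x"
proof -
  obtain b u where x: "x = el b u" "b \<in> A" using assms(2) by (rule Gam_cases)
  then have "a + phi v * b \<in> A" using assms(3) by (auto intro: loc_add A_phi_mult)
  then show ?thesis using assms moves_represents[of w b u a v] x
    by (simp add: word_val_push edge_def)
qed

lemma generated:
  assumes "x \<in> carrier Gam" shows "\<exists>w\<in>words S. word_val Gam w = x"
proof -
  obtain w where w: "represents w x" using represents_ex[OF assms] by blast
  then have "push (\<lambda>_. 0, 0) w \<in> words S"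
    by (intro push_words) (auto simp: valid_def represents_def)
  moreover have "word_val Gam (push (\<lambda>_. 0, 0) w) = x"
    by (rule word_val_push_represents[OF w assms]) simp
  ultimately show ?thesis by blast
qed

definition letter_val :: "nat \<times> bool \<Rightarrow> nat" where
  "letter_val x = (if snd x then fst x else inv\<^bsub>Gam\<^esub> (fst x))"

definition expand :: "nat \<times> bool \<Rightarrow> place gen list" where
  "expand x = (SOME w. represents w (letter_val x))"

lemma letter_val_S: "fst x \<in> S \<Longrightarrow> letter_val x \<in> S"
  by (simp add: letter_val_def S_inv)

lemma represents_expand: "fst x \<in> S \<Longrightarrow> represents (expand x) (letter_val x)"
  unfolding expand_def by (rule someI_ex[OF represents_ex]) (use letter_val_S S_carrier in blast)

lemma represents_expand_word:
  "w \<in> words S \<Longrightarrow> represents (concat (map expand w)) (word_val Gam w)"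
proof (induction w)
  case Nil
  then show ?case by (simp add: represents_def Gam_one)
next
  case (Cons x w)
  then have x: "fst x \<in> S" "w \<in> words S" by auto
  have "represents (expand x @ concat (map expand w)) (letter_val x \<otimes>\<^bsub>Gam\<^esub> word_val Gam w)"
  proof (rule represents_append)
    show "letter_val x \<in> carrier Gam" using letter_val_S[OF x(1)] S_carrier by blast
  qed (use Cons.IH x represents_expand[OF x(1)] Gam.word_val_closed[OF S_carrier] in auto)
  then show ?case by (simp add: Gam.word_val_Cons letter_val_def)
qed

text \<open>Each letter is exchanged in one replacement for the transport of its expansion. The
  start \<open>(a, v)\<close> must vary, since the path has moved along the diagonal after each
  letter.\<close>

lemma expand_chain:
  assumes l: "1 \<le> l" "\<And>x. fst x \<in> S \<Longrightarrow> length (expand x) \<le> l"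
  shows "w \<in> words S \<Longrightarrow> a \<in> A \<Longrightarrow>
    chain (short_eq Gam S l) (length w) w (push (\<lambda>_. a, v) (concat (map expand w)))"
proof (induction w arbitrary: a v)
  case Nil
  then show ?case by (simp add: chain.chain_refl)
next
  case (Cons x w)
  then have x: "fst x \<in> S" "w \<in> words S" by auto
  have lv: "letter_val x \<in> carrier Gam" using letter_val_S[OF x(1)] S_carrier by blast
  then obtain b u where bu: "letter_val x = el b u" "b \<in> A" by (rule Gam_cases)
  have r: "represents (expand x) (el b u)" using represents_expand[OF x(1)] bu by simp
  let ?s = "(\<lambda>_. a, v)"
  have "short_eq Gam S l [x] (push ?s (expand x))"
    unfolding short_eq_def
  proof (intro conjI)
    show "push ?s (expand x) \<in> words S"
      using r Cons.prems by (intro push_words) (auto simp: valid_def represents_def)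
    show "word_val Gam [x] = word_val Gam (push ?s (expand x))"
      using word_val_push_represents[OF represents_expand[OF x(1)] lv Cons.prems(2)] lv
      by (simp add: Gam.word_val_Cons letter_val_def)
  qed (use x l in auto)
  then have 1: "chain (short_eq Gam S l) (Suc 0) [x] (push ?s (expand x))" by (rule chain_one)
  have "a + phi v * b \<in> A" using Cons.prems bu by (auto intro: loc_add A_phi_mult)
  note 2 = Cons.IH[OF x(2) this, of "v + u"]
  show ?case using chain_append[OF 1 2] by (simp add: push_append moves_represents[OF r])
qed

text \<open>A relation is expanded letter by letter, the expansion is filled in the model by
  \<open>quadratic_filling\<close>, and this filling is transported by
  \<open>push_chain\<close>.\<close>

lemma quadratic_chains:
  "\<exists>l C. \<forall>w\<in>relations Gam S. chain (short_eq Gam S l) (C * (length w)\<^sup>2) w []"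
proof -
  obtain K where K: "\<And>x. fst x \<in> S \<Longrightarrow> length (expand x) \<le> K"
  proof -
    have "finite (S \<times> (UNIV :: bool set))" using finite_S by simp
    then have fin: "finite (length ` expand ` (S \<times> UNIV))" by blast
    show ?thesis
    proof (rule that[of "Max (length ` expand ` (S \<times> UNIV))"])
      fix x :: "nat \<times> bool" assume "fst x \<in> S"
      then have "x \<in> S \<times> UNIV" by (cases x) auto
      then show "length (expand x) \<le> Max (length ` expand ` (S \<times> UNIV))"
        using fin by (intro Max_ge) auto
    qed
  qed
  \<comment> \<open>\<open>K\<close> accommodates the expansions of single letters, 40 the
    transported relations of the model.\<close>
  define l where "l = K + 40"
  have "chain (short_eq Gam S l) ((40000 * K\<^sup>2 + 1) * (length w)\<^sup>2) w []" if w: "w \<in> relations Gam S" for w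
  proof -
    have wS: "w \<in> words S" and w1: "word_val Gam w = el 0 0" using w by (auto simp: relations_def Gam_one)
    let ?W = "concat (map expand w)" and ?s = "(\<lambda>_. 0, 0)"
    have l: "1 \<le> l" "\<And>x. fst x \<in> S \<Longrightarrow> length (expand x) \<le> l"
      using K by (auto simp: l_def trans_le_add1)
    have 1: "chain (short_eq Gam S l) (length w) w (push ?s ?W)"
      by (rule expand_chain[OF l wS]) simp_all
    have r: "ok ?W" "\<And>i. coord i ?W = 0" "sum_list (steps ?W) = 0"
      using represents_expand_word[OF wS] w1 by (auto simp: represents_def)
    have 2: "chain (short_eq Gam S l) (40000 * (length ?W)\<^sup>2) (push ?s ?W) (push ?s [])"
      by (rule push_chain[OF _ _ quadratic_filling[OF r(1,3,2)] r(1)]) (simp_all add: l_def valid_def)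
    have "w \<in> words S \<Longrightarrow> length (concat (map expand w)) \<le> K * length w" for w
    proof (induction w)
      case (Cons x w)
      then have "length (expand x) \<le> K" "length (concat (map expand w)) \<le> K * length w" using K by auto
      then show ?case by simp
    qed simp
    then have "(length ?W)\<^sup>2 \<le> (K * length w)\<^sup>2" using wS by (intro power_mono) auto
    moreover have "length w \<le> (length w)\<^sup>2" by (simp add: power2_eq_square Suc_le_eq)
    ultimately have "length w + 40000 * (length ?W)\<^sup>2 \<le> (length w)\<^sup>2 + 40000 * (K * length w)\<^sup>2"
      by linarith
    also have "\<dots> = (40000 * K\<^sup>2 + 1) * (length w)\<^sup>2" by (simp add: power_mult_distrib algebra_simps)
    finally show ?thesis using chain_mono[OF chain_trans[OF 1 2]] by simp
  qed
  then show ?thesis by blast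
qed

end

section \<open>Homomorphisms out of free groups\<close>

text \<open>A variant of \<open>word_val\<close> whose letters need not be elements of the target
  group; it is used with values in the Heisenberg group and for the generators of BS(1,n).\<close>

definition free_lift :: "('h, 'c) monoid_scheme \<Rightarrow> ('a \<Rightarrow> 'h) \<Rightarrow> 'a word \<Rightarrow> 'h" where
  "free_lift H f w = foldr (\<lambda>(s, e) g. (if e then f s else inv\<^bsub>H\<^esub> f s) \<otimes>\<^bsub>H\<^esub> g) w \<one>\<^bsub>H\<^esub>"

lemma free_lift_Nil [simp]: "free_lift H f [] = \<one>\<^bsub>H\<^esub>"
  by (simp add: free_lift_def)

lemma free_lift_Cons:
  "free_lift H f (x # w) = (if snd x then f (fst x) else inv\<^bsub>H\<^esub> f (fst x)) \<otimes>\<^bsub>H\<^esub> free_lift H f w"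
  by (simp add: free_lift_def case_prod_beta)

context group
begin

lemma free_lift_closed:
  assumes "f ` X \<subseteq> carrier G" shows "w \<in> words X \<Longrightarrow> free_lift G f w \<in> carrier G"
  using assms by (induction w) (auto simp: free_lift_Cons image_subset_iff)

lemma free_lift_append:
  assumes f: "f ` X \<subseteq> carrier G" and v: "v \<in> words X"
  shows "u \<in> words X \<Longrightarrow> free_lift G f (u @ v) = free_lift G f u \<otimes> free_lift G f v"
proof (induction u)
  case Nil
  then show ?case using free_lift_closed[OF f v] by simp
next
  case (Cons x u)
  then have "u \<in> words X" "f (fst x) \<in> carrier G" using f by auto
  with Cons.IH show ?case
    using free_lift_closed[OF f] v by (simp add: free_lift_Cons m_assoc)
qed

lemma free_lift_push_letter:
  assumes f: "f ` X \<subseteq> carrier G" and xw: "x # w \<in> words X"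
  shows "free_lift G f (push_letter x w) = free_lift G f (x # w)"
proof (cases w)
  case (Cons y v)
  then have "v \<in> words X" "f (fst x) \<in> carrier G" using f xw by auto
  then show ?thesis using Cons free_lift_closed[OF f]
    by (auto simp: free_lift_Cons letter_inv_def m_assoc[symmetric])
qed simp

lemma free_lift_free_reduce:
  assumes f: "f ` X \<subseteq> carrier G"
  shows "w \<in> words X \<Longrightarrow> free_lift G f (free_reduce w) = free_lift G f w"
proof (induction w)
  case (Cons x w)
  then have "x # free_reduce w \<in> words X" using free_reduce_words by auto
  then have "free_lift G f (push_letter x (free_reduce w)) = free_lift G f (x # free_reduce w)"
    by (rule free_lift_push_letter[OF f])
  then show ?case using Cons by (simp add: free_lift_Cons free_reduce_def)
qed (simp add: free_reduce_def)

lemma free_lift_hom: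
  assumes f: "f ` X \<subseteq> carrier G"
  shows "free_lift G f \<in> hom (free_group X) G"
proof (rule homI)
  fix u v assume "u \<in> carrier (free_group X)" "v \<in> carrier (free_group X)"
  then show "free_lift G f (u \<otimes>\<^bsub>free_group X\<^esub> v) = free_lift G f u \<otimes> free_lift G f v"
    using free_lift_free_reduce[OF f] free_lift_append[OF f] by (simp add: free_group_def)
qed (use free_lift_closed[OF f] in \<open>auto simp: free_group_def\<close>)

end

section \<open>Quadratic Dehn functions\<close>

lemma (in group) quadratic_dehn_functionI:
  assumes data: "dehn_data G S l"
    and upper: "\<And>w. w \<in> relations G S \<Longrightarrow> area G S l w \<le> C * (length w)\<^sup>2"
    and lower: "\<And>k. \<exists>w\<in>relations G S. length w \<le> 4 * k \<and> k\<^sup>2 \<le> M * area G S l w"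
  shows "quadratic_dehn_function G"
proof -
  let ?D = "dehn_function G S l"
  let ?A = "\<lambda>x. {area G S l w | w. w \<in> relations G S \<and> real (length w) \<le> x}"
  have "finite S" using data by (simp add: dehn_data_def)
  have fin: "finite (?A x)" for x
  proof -
    have eq: "?A x = area G S l ` {w \<in> relations G S. real (length w) \<le> x}" by auto
    show ?thesis unfolding eq by (rule finite_imageI[OF finite_relations_le[OF \<open>finite S\<close>]])
  qed
  have up: "?D x \<le> C * x\<^sup>2" if "x \<ge> 0" for x :: real
  proof -
    \<comment> \<open>The empty word is a relation of length 0, so for \<open>x \<ge> 0\<close> the
      supremum is a maximum attained by some relation.\<close>
    have ne: "?A x \<noteq> {}" using that by (auto simp: relations_def intro!: exI[of _ "[]"])
    have "Sup (?A x) \<in> ?A x" by (simp only: Sup_nat_def ne if_False Max_in[OF fin ne])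
    then obtain w where w: "Sup (?A x) = area G S l w" "w \<in> relations G S" "real (length w) \<le> x" by auto
    have "real (area G S l w) \<le> real (C * (length w)\<^sup>2)" using upper[OF w(2)] by (simp only: of_nat_le_iff)
    also have "\<dots> \<le> C * x\<^sup>2" using w(3) by (auto intro!: mult_left_mono power_mono)
    finally show ?thesis by (simp add: dehn_function_def w(1))
  qed
  have low: "(real k)\<^sup>2 \<le> M * ?D x" if "4 * real k \<le> x" for k :: nat and x :: real
  proof -
    obtain w where w: "w \<in> relations G S" "length w \<le> 4 * k" "k\<^sup>2 \<le> M * area G S l w"
      using lower by blast
    then have "real (length w) \<le> x" using that by linarith
    then have "area G S l w \<le> Sup (?A x)" using w(1) by (intro cSup_upper bdd_above_finite fin) auto
    then have "k\<^sup>2 \<le> M * Sup (?A x)" using w(3) by (meson le_trans mult_le_mono2)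
    then have "real (k\<^sup>2) \<le> real (M * Sup (?A x))" by (simp only: of_nat_le_iff)
    then show ?thesis by (simp add: dehn_function_def)
  qed
  have nonneg: "?D x \<ge> 0" for x by (simp add: dehn_function_def)
  have "?D \<approx> (\<lambda>n. n\<^sup>2)"
    unfolding dehn_equiv_def
  proof (rule exI[of _ "1 / (real C + 1)"], rule exI[of _ 1], rule exI[of _ 1], rule exI[of _ 1],
      rule exI[of _ "real M + 1"], rule exI[of _ 4], rule exI[of _ 2], rule exI[of _ 1], intro conjI allI impI)
    fix x :: real assume x: "x \<ge> 0"
    have "?D (1 * x) \<le> (real C + 1) * x\<^sup>2"
      using up[OF x] zero_le_power2[of x] unfolding distrib_right mult_1 by linarith
    then have "1 / (real C + 1) * ?D (1 * x) \<le> x\<^sup>2" by (simp add: field_simps)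
    then show "1 / (real C + 1) * ?D (1 * x) - 1 * x - 1 \<le> x\<^sup>2" using x by linarith
    \<comment> \<open>The lower bound is available for multiples of 4 only. Rounding
      \<open>x\<close> down to \<open>k\<close> changes the square by at most
      \<open>2 * x + 1\<close>, which the last two constants absorb.\<close>
    define k where "k = nat \<lfloor>x\<rfloor>"
    have k: "real k \<le> x" "x \<le> real k + 1" using x unfolding k_def by linarith+
    have "x\<^sup>2 \<le> (real k + 1)\<^sup>2" using k x by (intro power_mono)
    also have "\<dots> = (real k)\<^sup>2 + 2 * real k + 1" by (simp add: power2_eq_square algebra_simps)
    also have "\<dots> \<le> (real M + 1) * ?D (4 * x) + 2 * x + 1"
      using low[of k "4 * x"] nonneg[of "4 * x"] k by (simp add: algebra_simps)
    finally show "x\<^sup>2 \<le> (real M + 1) * ?D (4 * x) + 2 * x + 1" .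
  qed auto
  then show ?thesis unfolding quadratic_dehn_function_def using data by blast
qed

section \<open>The lower bound\<close>

text \<open>The integral Heisenberg group, in coordinates in which the third entry accumulates
  \<open>x dy\<close> along a path in Z^2. For a closed path it is the enclosed signed area.\<close>

definition heis :: "(int \<times> int \<times> int) monoid" where
  "heis = \<lparr>carrier = UNIV,
     mult = (\<lambda>u v. (fst u + fst v, fst (snd u) + fst (snd v), snd (snd u) + snd (snd v) + fst u * fst (snd v))),
     one = (0, 0, 0)\<rparr>"

lemma heis_mult [simp]: "(x, y, c) \<otimes>\<^bsub>heis\<^esub> (x', y', c') = (x + x', y + y', c + c' + x * y')"
  and heis_one: "\<one>\<^bsub>heis\<^esub> = (0, 0, 0)" and heis_carrier [simp]: "carrier heis = UNIV"
  by (simp_all add: heis_def)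

interpretation heis: group heis
proof (rule groupI)
  fix u v w :: "int \<times> int \<times> int"
  show "u \<otimes>\<^bsub>heis\<^esub> v \<otimes>\<^bsub>heis\<^esub> w = u \<otimes>\<^bsub>heis\<^esub> (v \<otimes>\<^bsub>heis\<^esub> w)"
    by (cases u; cases v; cases w) (simp add: algebra_simps)
next
  fix u :: "int \<times> int \<times> int"
  show "\<one>\<^bsub>heis\<^esub> \<otimes>\<^bsub>heis\<^esub> u = u" by (cases u) (simp add: heis_one)
  obtain x y c where u: "u = (x, y, c)" by (cases u)
  show "\<exists>v\<in>carrier heis. v \<otimes>\<^bsub>heis\<^esub> u = \<one>\<^bsub>heis\<^esub>"
    by (rule bexI[of _ "(- x, - y, x * y - c)"]) (simp_all add: u heis_one)
qed simp_all

lemma heis_inv [simp]: "inv\<^bsub>heis\<^esub> (x, y, c) = (- x, - y, x * y - c)"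
  by (rule heis.inv_equality) (simp_all add: heis_one)

text \<open>Elements over the origin are central; hence conjugating a relation does not change its
  enclosed area.\<close>

lemma heis_conj_center: "g \<otimes>\<^bsub>heis\<^esub> (0, 0, c) \<otimes>\<^bsub>heis\<^esub> inv\<^bsub>heis\<^esub> g = (0, 0, c)"
  by (cases g) (simp add: algebra_simps)

section \<open>Signed area of words over the generators\<close>

context bs_parameter
begin

text \<open>Applied to letters only and extended through the free group; it is not a homomorphism on
  \<open>Gam\<close>, and its failure to be one is what the signed area measures.\<close>

definition to_heis :: "nat \<Rightarrow> int \<times> int \<times> int" where
  "to_heis x = (fst (bas x), fst (snd (bas x)), 0)"

lemma to_heis_el [simp]: "to_heis (el a v) = (fst v, fst (snd v), 0)"
  by (simp add: to_heis_def)

abbreviation signed :: "nat word \<Rightarrow> int \<times> int \<times> int" where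
  "signed \<equiv> free_lift heis to_heis"

lemma signed_base:
  "w \<in> words S \<Longrightarrow> fst (signed w) = fst (bas (word_val Gam w)) \<and>
     fst (snd (signed w)) = fst (snd (bas (word_val Gam w)))"
proof (induction w)
  case Nil
  then show ?case by (simp add: heis_one Gam_one)
next
  case (Cons x w)
  then have "fst x \<in> carrier Gam" "word_val Gam w \<in> carrier Gam"
    using S_carrier Gam.word_val_closed[OF S_carrier] by auto
  then obtain a v b u where 1: "fst x = el a v" "a \<in> A" "word_val Gam w = el b u" "b \<in> A"
    by (elim Gam_cases) blast
  obtain p1 p2 p3 where 2: "signed w = (p1, p2, p3)" by (cases "signed w")
  show ?case using Cons 1 2
    by (cases v; cases u) (auto simp: free_lift_Cons Gam.word_val_Cons)
qed

lemma signed_relation: "w \<in> relations Gam S \<Longrightarrow> \<exists>c. signed w = (0, 0, c)"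
  using signed_base[of w] by (cases "signed w") (auto simp: relations_def Gam_one)

text \<open>The areas of the conjugated factors of a filling add up, and \<open>M\<close> is the
  largest absolute area among the finitely many relations of length at most
  \<open>l\<close>.\<close>

lemma signed_area_bound:
  "\<exists>M::nat. \<forall>w\<in>words S. \<forall>m. fills_with Gam S l w m \<longrightarrow> \<bar>snd (snd (signed w))\<bar> \<le> int M * int m"
proof -
  interpret F: group "free_group S" by (rule group_free_group)
  interpret h: group_hom "free_group S" heis signed
    using heis.free_lift_hom[of to_heis S] by unfold_locales simp
  let ?R = "{w \<in> relations Gam S. real (length w) \<le> real l}"
  define M where "M = Max (insert 0 ((\<lambda>w. nat \<bar>snd (snd (signed w))\<bar>) ` ?R))"
  have fin: "finite ?R" by (rule finite_relations_le[OF finite_S])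
  have M: "\<bar>snd (snd (signed r))\<bar> \<le> int M" if "r \<in> relations Gam S" "length r \<le> l" for r
  proof -
    have "nat \<bar>snd (snd (signed r))\<bar> \<le> M"
      unfolding M_def using fin that by (intro Max_ge) auto
    then show ?thesis by simp
  qed
  have fr: "signed (free_reduce r) = signed r" if "r \<in> words S" for r
    using heis.free_lift_free_reduce[of to_heis S] that by simp
  have cp: "\<exists>c. signed (conj_product S ps) = (0, 0, c) \<and> \<bar>c\<bar> \<le> int M * int (length ps)"
    if "\<forall>(g, r)\<in>set ps. g \<in> carrier (free_group S) \<and> r \<in> relations Gam S \<and> length r \<le> l" for ps
    using that
  proof (induction ps)
    case Nil
    then show ?case using h.hom_one by (simp add: conj_product_def heis_one)
  next
    case (Cons x ps)
    obtain g r where x: "x = (g, r)" by fastforce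
    with Cons.prems have g: "g \<in> carrier (free_group S)" and r: "r \<in> relations Gam S" "length r \<le> l" by auto
    have rS: "r \<in> words S" using r by (simp add: relations_def)
    from Cons obtain c where c: "signed (conj_product S ps) = (0, 0, c)" "\<bar>c\<bar> \<le> int M * int (length ps)" by auto
    obtain d where d: "signed r = (0, 0, d)" using signed_relation[OF r(1)] by blast
    then have "\<bar>d\<bar> \<le> int M" using M[OF r] by simp
    have pc: "conj_product S ps \<in> carrier (free_group S)"
      by (rule conj_product_closed) (use Cons.prems in \<open>auto simp: relations_def\<close>)
    have rc: "free_reduce r \<in> carrier (free_group S)" by (rule free_reduce_in_free_group[OF rS])
    have "conj_product S (x # ps) = (g \<otimes>\<^bsub>free_group S\<^esub> free_reduce r \<otimes>\<^bsub>free_group S\<^esub> inv\<^bsub>free_group S\<^esub> g)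
        \<otimes>\<^bsub>free_group S\<^esub> conj_product S ps"
      by (simp add: conj_product_def x)
    then have "signed (conj_product S (x # ps)) = (0, 0, d) \<otimes>\<^bsub>heis\<^esub> (0, 0, c)"
      using g rc pc by (simp add: fr[OF rS] d c(1) heis_conj_center)
    moreover have "\<bar>d + c\<bar> \<le> int M * int (length (x # ps))"
      using \<open>\<bar>d\<bar> \<le> int M\<close> c(2) by (simp add: algebra_simps)
    ultimately show ?case by simp
  qed
  show ?thesis
  proof (intro exI[of _ M] ballI allI impI)
    fix w m assume w: "w \<in> words S" and "fills_with Gam S l w m"
    then obtain ps where ps: "length ps \<le> m" "free_reduce w = conj_product S ps"
      "\<forall>(g, r)\<in>set ps. g \<in> carrier (free_group S) \<and> r \<in> relations Gam S \<and> length r \<le> l"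
      by (auto simp: fills_with_def)
    obtain c where c: "signed w = (0, 0, c)" "\<bar>c\<bar> \<le> int M * int (length ps)"
      using cp[OF ps(3)] fr[OF w] ps(2) by auto
    have "int M * int (length ps) \<le> int M * int m" using ps(1) by (intro mult_left_mono) auto
    then show "\<bar>snd (snd (signed w))\<bar> \<le> int M * int m" using c by simp
  qed
qed

text \<open>The commutator of the \<open>k\<close>-th powers of the first two basis vectors of Z^3:
  its projection runs around a square of side \<open>k\<close>.\<close>

definition square :: "nat \<Rightarrow> nat word" where
  "square k = (let s = el 0 (1, 0, 0); t = el 0 (0, 1, 0) in
     replicate k (s, True) @ replicate k (t, True) @ replicate k (s, False) @ replicate k (t, False))"

lemma el_unit_S: "e \<in> unit_steps \<Longrightarrow> el 0 e \<in> S"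
  unfolding S_def S0_def by (rule UnI1, unfold mem_Collect_eq, intro exI[of _ 0] exI[of _ e])
    (use PQ(1,2) in simp)

lemma square_relation: "square k \<in> relations Gam S" "length (square k) = 4 * k"
  "signed (square k) = (0, 0, (int k)\<^sup>2)"
proof -
  let ?s = "el 0 (1, 0, 0)" and ?t = "el 0 (0, 1, 0)"
  have st: "?s \<in> S" "?t \<in> S" by (auto intro!: el_unit_S simp: unit_steps_def)
  have rep: "replicate k (x, b) \<in> words S" if "x \<in> S" for x b
    using that by (induction k) auto
  have val: "word_val Gam (replicate k (el 0 (x, y, z), b)) =
      (if b then el 0 (int k * x, int k * y, int k * z) else el 0 (- int k * x, - int k * y, - int k * z))"
    for x y z b k
    by (induction k) (auto simp: Gam.word_val_Cons Gam_one zero_prod_def algebra_simps)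
  have sq: "square k \<in> words S" using st rep by (simp add: square_def Let_def)
  have "word_val Gam (square k) = \<one>\<^bsub>Gam\<^esub>"
    using st by (simp add: square_def Let_def rep Gam.word_val_append[OF S_carrier] val Gam_one zero_prod_def)
  with sq show "square k \<in> relations Gam S" by (simp add: relations_def)
  show "length (square k) = 4 * k" by (simp add: square_def Let_def)
  have sg1: "signed (replicate k (?s, b)) = (if b then (int k, 0, 0) else (- int k, 0, 0))" for b k
    by (induction k) (auto simp: free_lift_Cons heis_one)
  have sg2: "signed (replicate k (?t, b)) = (if b then (0, int k, 0) else (0, - int k, 0))" for b k
    by (induction k) (auto simp: free_lift_Cons heis_one)
  have app: "signed (u @ v) = signed u \<otimes>\<^bsub>heis\<^esub> signed v" if "u \<in> words S" "v \<in> words S" for u v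
    using that by (intro heis.free_lift_append) auto
  show "signed (square k) = (0, 0, (int k)\<^sup>2)"
    using st by (simp add: square_def Let_def app rep sg1 sg2 power2_eq_square)
qed

theorem Gam_quadratic: "finitely_presented Gam" "quadratic_dehn_function Gam"
proof -
  obtain l C where chains: "\<And>w. w \<in> relations Gam S \<Longrightarrow> chain (short_eq Gam S l) (C * (length w)\<^sup>2) w []"
    using quadratic_chains by blast
  have data: "dehn_data Gam S (2 * l)" "finitely_presented Gam"
    by (rule Gam.dehn_data_of_chains[OF S_carrier finite_S S_inv generated]; use chains in blast)+
  then show "finitely_presented Gam" by simp
  obtain M :: nat where M: "\<And>w m. w \<in> words S \<Longrightarrow> fills_with Gam S (2 * l) w m \<Longrightarrow>
    \<bar>snd (snd (signed w))\<bar> \<le> int M * int m" using signed_area_bound[of "2 * l"] by blast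
  show "quadratic_dehn_function Gam"
  proof (rule Gam.quadratic_dehn_functionI[OF data(1)])
    fix w assume "w \<in> relations Gam S"
    then show "area Gam S (2 * l) w \<le> C * (length w)\<^sup>2"
      using Gam.area_le_of_chain[OF S_carrier _ chains] by (auto simp: relations_def)
  next
    fix k
    have "fills_with Gam S (2 * l) (square k) (area Gam S (2 * l) (square k))"
      by (rule relation_has_filling[OF Gam.group_axioms data(1) square_relation(1)])
    from M[OF _ this] have "(int k)\<^sup>2 \<le> int M * int (area Gam S (2 * l) (square k))"
      using square_relation[of k] by (simp add: relations_def)
    then have "int (k\<^sup>2) \<le> int (M * area Gam S (2 * l) (square k))" by simp
    then have "k\<^sup>2 \<le> M * area Gam S (2 * l) (square k)" by (simp only: of_nat_le_iff)
    then show "\<exists>w\<in>relations Gam S. length w \<le> 4 * k \<and> k\<^sup>2 \<le> M * area Gam S (2 * l) w"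
      using square_relation(1,2)[of k] by (intro bexI[of _ "square k"] conjI) simp_all
  qed
qed

section \<open>The commutator subgroup\<close>

lemma Gam_metabelian: "metabelian Gam"
proof -
  let ?D = "derived Gam (carrier Gam)"
  have sub: "subgroup ?D Gam" by (rule Gam.derived_is_subgroup) simp
  have "subgroup {el a 0 | a. a \<in> A} Gam"
  proof (rule Gam.subgroupI)
    show "{el a 0 | a. a \<in> A} \<noteq> {}" using of_int_loc(2) by blast
  qed (auto intro: loc_uminus loc_add)
  \<comment> \<open>The quotient Z^3 is abelian, so commutators have trivial component
    there.\<close>
  moreover have "derived_set Gam (carrier Gam) \<subseteq> {el a 0 | a. a \<in> A}"
  proof clarify
    fix x y assume "x \<in> carrier Gam" "y \<in> carrier Gam"
    then show "\<exists>a. x \<otimes>\<^bsub>Gam\<^esub> y \<otimes>\<^bsub>Gam\<^esub> inv\<^bsub>Gam\<^esub> x \<otimes>\<^bsub>Gam\<^esub> inv\<^bsub>Gam\<^esub> y = el a 0 \<and> a \<in> A"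
      by (elim Gam_cases) (auto intro!: loc_add loc_diff loc_uminus A_phi_mult)
  qed
  ultimately have D: "?D \<subseteq> {el a 0 | a. a \<in> A}"
    unfolding derived_def by (intro Gam.generate_subgroup_incl)
  have "comm_group (Gam\<lparr>carrier := ?D\<rparr>)"
  proof (rule group.group_comm_groupI)
    show "group (Gam\<lparr>carrier := ?D\<rparr>)" by (rule subgroup.subgroup_is_group[OF sub Gam.group_axioms])
    fix x y assume "x \<in> carrier (Gam\<lparr>carrier := ?D\<rparr>)" "y \<in> carrier (Gam\<lparr>carrier := ?D\<rparr>)"
    then have "x \<in> {el a 0 | a. a \<in> A}" "y \<in> {el a 0 | a. a \<in> A}" using D by auto
    then obtain a b where "x = el a 0" "y = el b 0" by blast
    then show "x \<otimes>\<^bsub>Gam\<lparr>carrier := ?D\<rparr>\<^esub> y = y \<otimes>\<^bsub>Gam\<lparr>carrier := ?D\<rparr>\<^esub> x"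
      by simp
  qed
  then show ?thesis using Gam.group_axioms by (simp add: metabelian_def)
qed

end

section \<open>The Baumslag--Solitar subgroup\<close>

context group
begin

lemma eq_of_mult_inv: "a \<otimes> inv b = \<one> \<Longrightarrow> a \<in> carrier G \<Longrightarrow> b \<in> carrier G \<Longrightarrow> a = b"
  by (metis inv_equality inv_closed inv_inv)

definition bs_normal_forms :: "'a \<Rightarrow> 'a \<Rightarrow> 'a set" where
  "bs_normal_forms t x = {inv (t [^] i) \<otimes> x [^] j \<otimes> t [^] k | (i::nat) (j::int) (k::nat). True}"

lemma bs_conj_pow:
  fixes n j :: int
  assumes t: "t \<in> carrier G" and x: "x \<in> carrier G" and rel: "t \<otimes> x \<otimes> inv t = x [^] n"
  shows "t [^] (i::nat) \<otimes> x [^] j = x [^] (n ^ i * j) \<otimes> t [^] i"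
proof -
  have "(\<lambda>y. t \<otimes> y \<otimes> inv t) \<in> hom G G"
  proof (rule homI)
    fix y z assume "y \<in> carrier G" "z \<in> carrier G"
    then show "t \<otimes> (y \<otimes> z) \<otimes> inv t = t \<otimes> y \<otimes> inv t \<otimes> (t \<otimes> z \<otimes> inv t)"
      using t by (simp add: m_assoc) (simp add: m_assoc[symmetric])
  qed (use t in simp)
  from hom_int_pow[OF this x is_group is_group]
  have c: "t \<otimes> x [^] j \<otimes> inv t = x [^] (n * j)" for j :: int
    using x by (simp add: rel int_pow_pow)
  have 1: "t \<otimes> x [^] j = x [^] (n * j) \<otimes> t" for j :: int
    using t x by (simp flip: c add: m_assoc)
  show ?thesis
  proof (induction i arbitrary: j)
    case 0
    then show ?case using x by simp
  next
    case (Suc i)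
    have "t [^] Suc i \<otimes> x [^] j = t [^] i \<otimes> (t \<otimes> x [^] j)" using t x by (simp add: m_assoc)
    also have "\<dots> = (t [^] i \<otimes> x [^] (n * j)) \<otimes> t" using t x by (simp add: 1 m_assoc)
    also have "\<dots> = x [^] (n ^ i * (n * j)) \<otimes> (t [^] i \<otimes> t)" using t x by (simp add: Suc.IH m_assoc)
    finally show ?case by (simp add: mult_ac)
  qed
qed

text \<open>A factor \<open>t\<close> cancels against \<open>t^-i\<close> or, if
  \<open>i = 0\<close>, passes \<open>x^j\<close>; a factor \<open>x^c\<close> passes
  \<open>t^-i\<close> and becomes \<open>x^(n^i c)\<close>. Being closed under left multiplication
  by the generators and their inverses, the forms \<open>t^-i x^j t^k\<close> exhaust the subgroup
  generated by \<open>t\<close> and \<open>x\<close>.\<close>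

lemma bs_normal_forms_step:
  fixes n :: int
  assumes t: "t \<in> carrier G" and x: "x \<in> carrier G" and rel: "t \<otimes> x \<otimes> inv t = x [^] n"
    and y: "y \<in> bs_normal_forms t x"
  shows "t \<otimes> y \<in> bs_normal_forms t x" "inv t \<otimes> y \<in> bs_normal_forms t x"
    "x [^] (c::int) \<otimes> y \<in> bs_normal_forms t x"
proof -
  obtain i k :: nat and j :: int where y: "y = inv (t [^] i) \<otimes> x [^] j \<otimes> t [^] k"
    using y by (auto simp: bs_normal_forms_def)
  show "t \<otimes> y \<in> bs_normal_forms t x"
  proof (cases i)
    case 0
    have "t \<otimes> y = (t [^] (1::nat) \<otimes> x [^] j) \<otimes> t [^] k" using t x by (simp add: y 0 m_assoc)
    also have "\<dots> = inv (t [^] (0::nat)) \<otimes> x [^] (n * j) \<otimes> (t [^] (1::nat) \<otimes> t [^] k)"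
      unfolding bs_conj_pow[OF t x rel] using t x by (simp add: m_assoc)
    also have "\<dots> = inv (t [^] (0::nat)) \<otimes> x [^] (n * j) \<otimes> t [^] (Suc k)"
      by (simp only: nat_pow_mult[OF t] plus_1_eq_Suc)
    finally show ?thesis unfolding bs_normal_forms_def by blast
  next
    case (Suc i')
    have "t \<otimes> inv (t [^] Suc i') = inv (t [^] i')"
      using t by (simp add: inv_mult_group m_assoc[symmetric])
    then have "t \<otimes> y = inv (t [^] i') \<otimes> x [^] j \<otimes> t [^] k"
      using t x by (simp add: y Suc m_assoc[symmetric] del: nat_pow_Suc)
    then show ?thesis unfolding bs_normal_forms_def by blast
  qed
  have "inv t \<otimes> y = inv (t [^] Suc i) \<otimes> x [^] j \<otimes> t [^] k"
    using t x by (simp add: y inv_mult_group m_assoc)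
  then show "inv t \<otimes> y \<in> bs_normal_forms t x" unfolding bs_normal_forms_def by blast
  have "x [^] c \<otimes> inv (t [^] i) = inv (t [^] i) \<otimes> (t [^] i \<otimes> x [^] c) \<otimes> inv (t [^] i)"
    using t x by (simp add: m_assoc[symmetric])
  also have "\<dots> = inv (t [^] i) \<otimes> x [^] (n ^ i * c)"
    unfolding bs_conj_pow[OF t x rel] using t x by (simp add: m_assoc)
  finally have "x [^] c \<otimes> y = inv (t [^] i) \<otimes> (x [^] (n ^ i * c) \<otimes> x [^] j) \<otimes> t [^] k"
    using t x by (simp add: y m_assoc[symmetric])
  then have "x [^] c \<otimes> y = inv (t [^] i) \<otimes> x [^] (n ^ i * c + j) \<otimes> t [^] k"
    using x by (simp add: int_pow_mult)
  then show "x [^] c \<otimes> y \<in> bs_normal_forms t x" unfolding bs_normal_forms_def by blast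
qed

end

section \<open>Embedding of BS(1,n)\<close>

context bs_parameter
begin

definition bs_image :: "bs_gen \<Rightarrow> nat" where
  "bs_image g = (case g of BS_t \<Rightarrow> el 0 (0, 0, 1) | BS_x \<Rightarrow> el 1 0)"

abbreviation bsF :: "bs_gen word monoid" where
  "bsF \<equiv> free_group UNIV"

abbreviation bsh :: "bs_gen word \<Rightarrow> nat" where
  "bsh \<equiv> free_lift Gam bs_image"

sublocale bsF: group bsF
  by (rule group_free_group)

sublocale bsh: group_hom bsF Gam bsh
proof unfold_locales
  have "range bs_image \<subseteq> carrier Gam" by (auto simp: bs_image_def split: bs_gen.splits)
  then show "bsh \<in> hom bsF Gam" by (rule Gam.free_lift_hom)
qed

lemma el_pow: "el 1 0 [^]\<^bsub>Gam\<^esub> (j::int) = el (of_int j) 0" "el 0 (0, 0, 1) [^]\<^bsub>Gam\<^esub> (k::nat) = el 0 (0, 0, int k)"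
proof -
  have "el 1 0 [^]\<^bsub>Gam\<^esub> (m::nat) = el (of_nat m) 0" for m
    by (induction m) (auto simp: Gam_one)
  then show "el 1 0 [^]\<^bsub>Gam\<^esub> (j::int) = el (of_int j) 0" 
    using loc_uminus[OF of_int_loc(1)] by (simp add: int_pow_def2)
  show "el 0 (0, 0, 1) [^]\<^bsub>Gam\<^esub> (k::nat) = el 0 (0, 0, int k)"
    by (induction k) (auto simp: Gam_one zero_prod_def)
qed

text \<open>The relator is killed in \<open>Gam\<close>, which gives one inclusion. Conversely,
  modulo the relator every word equals a normal form \<open>t^-i x^j t^k\<close>, and
  \<open>Gam\<close> detects whether such a form is trivial.\<close>

lemma bs_kernel: "kernel bsF Gam bsh = normal_closure bsF (free_reduce ` {bs_relator n})"
proof -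
  define t where "t = [(BS_t, True)]"
  define x where "x = [(BS_x, True)]"
  have tx: "t \<in> carrier bsF" "x \<in> carrier bsF"
    by (auto simp: t_def x_def free_group_def reduced_def)
  have ht: "bsh t = el 0 (0, 0, 1)" and hx: "bsh x = el 1 0"
    by (simp_all add: t_def x_def free_lift_Cons bs_image_def Gam_one)
  let ?r = "(t \<otimes>\<^bsub>bsF\<^esub> x \<otimes>\<^bsub>bsF\<^esub> inv\<^bsub>bsF\<^esub> t) \<otimes>\<^bsub>bsF\<^esub> inv\<^bsub>bsF\<^esub> (x [^]\<^bsub>bsF\<^esub> n)"
  have r: "?r \<in> carrier bsF" using tx by simp
  have "reduced ?r" using r by (auto simp: free_group_def)
  then have rel: "free_reduce ` {bs_relator n} = {?r}"
    by (simp add: bs_relator_def Let_def t_def x_def)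
  define K where "K = normal_closure bsF {?r}"
  interpret K: normal K bsF unfolding K_def by (rule bsF.normal_normal_closure) (use r in simp)
  define B where "B = bsF Mod K"
  define pr where "pr w = K #>\<^bsub>bsF\<^esub> w" for w
  interpret B: group B unfolding B_def by (rule K.factorgroup_is_group)
  have "pr = (\<lambda>w. K #>\<^bsub>bsF\<^esub> w)" by (rule ext) (rule pr_def)
  then have "pr \<in> hom bsF B" using K.r_coset_hom_Mod by (simp add: B_def)
  then interpret pr: group_hom bsF B pr
    by (intro group_hom.intro group_hom_axioms.intro bsF.group_axioms B.group_axioms)
  have "phi (0, 0, 1) = of_int n" by (simp add: phi_def N_def)
  then have hr: "bsh ?r = \<one>\<^bsub>Gam\<^esub>"
    using tx by (simp add: ht hx bsh.hom_int_pow el_pow Gam_one flip: zero_prod_def)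
  have KK: "K \<subseteq> kernel bsF Gam bsh"
    unfolding K_def normal_closure_def
  proof (rule bsF.generate_subgroup_incl[OF _ bsh.subgroup_kernel], clarify)
    fix g assume "g \<in> carrier bsF"
    then show "g \<otimes>\<^bsub>bsF\<^esub> ?r \<otimes>\<^bsub>bsF\<^esub> inv\<^bsub>bsF\<^esub> g \<in> kernel bsF Gam bsh"
      using r hr by (simp add: kernel_def)
  qed
  have rK: "?r \<in> K"
  proof -
    have "\<one>\<^bsub>bsF\<^esub> \<otimes>\<^bsub>bsF\<^esub> ?r \<otimes>\<^bsub>bsF\<^esub> inv\<^bsub>bsF\<^esub> \<one>\<^bsub>bsF\<^esub> \<in> K"
      unfolding K_def normal_closure_def by (intro generate.incl) blast
    then show ?thesis using r by simp
  qed
  have "pr ?r = K" by (rule trans[OF pr_def K.rcos_const[OF bsF.group_axioms rK]])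
  then have "pr ?r = \<one>\<^bsub>B\<^esub>" by (simp only: B_def FactGroup_def monoid.simps)
  then have prr: "pr t \<otimes>\<^bsub>B\<^esub> pr x \<otimes>\<^bsub>B\<^esub> inv\<^bsub>B\<^esub> pr t \<otimes>\<^bsub>B\<^esub> inv\<^bsub>B\<^esub> (pr x [^]\<^bsub>B\<^esub> n) = \<one>\<^bsub>B\<^esub>"
    using tx by (simp only: pr.hom_mult pr.hom_inv pr.hom_int_pow bsF.m_closed bsF.inv_closed bsF.int_pow_closed)
  have cl: "pr t \<in> carrier B" "pr x \<in> carrier B" using tx by simp_all
  have Brel: "pr t \<otimes>\<^bsub>B\<^esub> pr x \<otimes>\<^bsub>B\<^esub> inv\<^bsub>B\<^esub> pr t = pr x [^]\<^bsub>B\<^esub> n"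
    by (rule B.eq_of_mult_inv[OF prr]) (simp_all add: cl)
  have nf: "pr (free_reduce w) \<in> B.bs_normal_forms (pr t) (pr x)" for w
  proof (induction w)
    case Nil
    have "pr (free_reduce []) = \<one>\<^bsub>B\<^esub>"
      using pr.hom_one by (simp add: free_reduce_def free_group_def)
    also have "\<dots> = inv\<^bsub>B\<^esub> (pr t [^]\<^bsub>B\<^esub> (0::nat)) \<otimes>\<^bsub>B\<^esub> pr x [^]\<^bsub>B\<^esub> (0::int) \<otimes>\<^bsub>B\<^esub> pr t [^]\<^bsub>B\<^esub> (0::nat)"
      by simp
    finally show ?case unfolding B.bs_normal_forms_def by blast
  next
    case (Cons g w)
    obtain s b where g: "g = (s, b)" by fastforce
    have wc: "free_reduce w \<in> carrier bsF" by (rule free_reduce_in_free_group) (simp add: words_def)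
    have gc: "[g] \<in> carrier bsF" by (simp add: free_group_def reduced_def)
    have "free_reduce (g # w) = [g] \<otimes>\<^bsub>bsF\<^esub> free_reduce w"
      using free_reduce_append_right[of "[g]" w] by (simp add: free_group_def)
    then have eq: "pr (free_reduce (g # w)) = pr [g] \<otimes>\<^bsub>B\<^esub> pr (free_reduce w)"
      using wc gc by simp
    note step = B.bs_normal_forms_step[OF cl Brel Cons.IH]
    have inv: "[(s, False)] = inv\<^bsub>bsF\<^esub> [(s, True)]" for s :: bs_gen
      using free_group_inv[of "[(s, True)]" UNIV] by (simp add: free_reduce_def letter_inv_def)
    show ?case
    proof (cases s)
      case BS_t
      show ?thesis
      proof (cases b)
        case True
        then have "[g] = t" by (simp add: g BS_t t_def)
        then show ?thesis using step(1) eq by simp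
      next
        case False
        then have "[g] = inv\<^bsub>bsF\<^esub> t" using inv by (simp add: g BS_t t_def)
        then show ?thesis using step(2) eq tx by simp
      qed
    next
      case BS_x
      show ?thesis
      proof (cases b)
        case True
        then have "[g] = x" by (simp add: g BS_x x_def)
        then show ?thesis using step(3)[of 1] eq cl by simp
      next
        case False
        then have "[g] = inv\<^bsub>bsF\<^esub> x" using inv by (simp add: g BS_x x_def)
        then show ?thesis using step(3)[of "-1"] eq tx cl by (simp add: B.int_pow_neg)
      qed
    qed
  qed
  have "kernel bsF Gam bsh \<subseteq> K"
  proof
    fix w assume "w \<in> kernel bsF Gam bsh"
    then have w: "w \<in> carrier bsF" "bsh w = \<one>\<^bsub>Gam\<^esub>" by (auto simp: kernel_def)
    then have "free_reduce w = w" by (simp add: free_group_def)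
    then obtain i k :: nat and j :: int where
      ijk: "pr w = inv\<^bsub>B\<^esub> (pr t [^]\<^bsub>B\<^esub> i) \<otimes>\<^bsub>B\<^esub> pr x [^]\<^bsub>B\<^esub> j \<otimes>\<^bsub>B\<^esub> pr t [^]\<^bsub>B\<^esub> k"
      using nf[of w] by (auto simp: B.bs_normal_forms_def)
    \<comment> \<open>The normal form of \<open>w\<close>, lifted to the free group. It lies in the
      same coset of \<open>K\<close> as \<open>w\<close>, so it is enough to show that
      \<open>c\<close> is trivial.\<close>
    define c where "c = inv\<^bsub>bsF\<^esub> (t [^]\<^bsub>bsF\<^esub> i) \<otimes>\<^bsub>bsF\<^esub> x [^]\<^bsub>bsF\<^esub> j \<otimes>\<^bsub>bsF\<^esub> t [^]\<^bsub>bsF\<^esub> k"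
    have cc: "c \<in> carrier bsF" using tx by (simp add: c_def)
    have "pr c = pr w"
      unfolding ijk c_def using tx by (simp add: pr.hom_nat_pow pr.hom_int_pow)
    then have "w \<in> K #>\<^bsub>bsF\<^esub> c"
      using bsF.rcos_self[OF w(1) K.subgroup_axioms] unfolding pr_def by blast
    then obtain m where m: "m \<in> K" "w = m \<otimes>\<^bsub>bsF\<^esub> c" by (auto simp: r_coset_def)
    then have "bsh m = \<one>\<^bsub>Gam\<^esub>" "m \<in> carrier bsF" using KK by (auto simp: kernel_def)
    then have "bsh c = \<one>\<^bsub>Gam\<^esub>" using w(2) m(2) cc by simp
    moreover have "bsh c = el (phi (0, 0, - int i) * of_int j) (0, 0, int k - int i)"
      unfolding c_def using tx by (simp add: ht hx bsh.hom_nat_pow bsh.hom_int_pow el_pow)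
    \<comment> \<open>\<open>phi\<close> has no zeros, so the component in \<open>A\<close> forces
      \<open>j = 0\<close>, and the component in Z^3 forces \<open>i = k\<close>.\<close>
    ultimately have "j = 0" "i = k" by (auto simp: Gam_one zero_prod_def)
    then have "c = \<one>\<^bsub>bsF\<^esub>" using tx by (simp add: c_def)
    then show "w \<in> K" using m \<open>m \<in> carrier bsF\<close> by simp
  qed
  with KK show ?thesis unfolding rel K_def by blast
qed

text \<open>The first isomorphism theorem for \<open>bsh\<close>, with the image taken as codomain
  to make the map surjective.\<close>

lemma bs_embeds: "\<exists>H. subgroup H Gam \<and> BS1 n \<cong> Gam\<lparr>carrier := H\<rparr>"
proof (intro exI conjI)
  let ?H = "bsh ` carrier bsF"
  show sub: "subgroup ?H Gam" by (rule bsh.img_is_subgroup)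
  interpret H: group "Gam\<lparr>carrier := ?H\<rparr>" by (rule subgroup.subgroup_is_group[OF sub Gam.group_axioms])
  interpret h: group_hom bsF "Gam\<lparr>carrier := ?H\<rparr>" bsh
    by unfold_locales (auto simp: hom_def)
  have "kernel bsF (Gam\<lparr>carrier := ?H\<rparr>) bsh = kernel bsF Gam bsh" by (simp add: kernel_def)
  with h.FactGroup_iso show "BS1 n \<cong> Gam\<lparr>carrier := ?H\<rparr>"
    by (simp add: BS1_def presented_group_def bs_kernel)
qed

end

theorem theorem1:
  fixes n :: int
  assumes "\<bar>n\<bar> \<ge> 1"
  shows "\<exists>\<Gamma> :: nat monoid.
           group \<Gamma> \<and> finitely_presented \<Gamma> \<and> metabelian \<Gamma> \<and> quadratic_dehn_function \<Gamma> \<and>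
           (\<exists>H. subgroup H \<Gamma> \<and> BS1 n \<cong> \<Gamma>\<lparr>carrier := H\<rparr>)"
proof -
  interpret bs_parameter n using assms by unfold_locales auto
  show ?thesis
    using Gam.group_axioms Gam_quadratic Gam_metabelian bs_embeds by blast
qed

end
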